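(* Let $N\ge 1$, let $\alpha\in\mathbb{C}^{N\times N}$ be Hermitian, let $V(x)=\alpha x^2+\mathbb{I}_N x^4$ and $\rho(x)=\exp(-V(x))$ for $x\in\mathbb{R}$. Let $\{P_n\}_{n\ge0}$ be the monic matrix orthogonal polynomials for $\rho(x)\,dx$, let $$c_n=\Big(-\frac{1}{2\pi i}\int_{\mathbb{R}}P_n(x)\rho(x)x^n\,dx\Big)^{-1},\qquad n\ge 0,$$ and let $\beta_0:=0$ and $\beta_n:=2c_n^{-1}c_{n-1}$ for $n\ge1$. Then $$\beta_{n+1}=n\beta_n^{-1}-\beta_{n-1}-\beta_n-\alpha,\qquad n=1,2,\dots$$
   Context: $\mathbb{I}_N$ is the $N\times N$ identity matrix and $\exp$ is the matrix exponential. The monic matrix orthogonal polynomials for $\rho(x)\,dx$ are the unique polynomials $P_n(x)=\mathbb{I}_N x^n+\gamma_n^{(1)}x^{n-1}+\cdots+\gamma_n^{(n)}$ with coefficients in $\mathbb{C}^{N\times N}$ such that $\int_{\mathbb{R}}P_n(x)x^j\rho(x)\,dx=0$ for $j=0,\dots,n-1$. The $\beta_n$ are the recursion coefficients in $P_{n+1}(z)=zP_n(z)-\tfrac12\beta_nP_{n-1}(z)$. *)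

theory Defs
  imports "HOL-Analysis.Analysis"
begin

text \<open>
  The type of complex square matrices does not carry the library's \<open>exp\<close>, \<open>^\<close> or \<open>*\<close> in the
  matrix sense (\<open>*\<close> on vectors is componentwise, and \<open>1\<close> is the all-ones matrix). The matrix
  product is \<open>**\<close> and the identity is \<open>mat 1\<close>.
\<close>

primrec mat_pow :: "complex^'n^'n \<Rightarrow> nat \<Rightarrow> complex^'n^'n" where
  "mat_pow A 0 = mat 1"
| "mat_pow A (Suc k) = A ** mat_pow A k"

definition mat_exp :: "complex^'n^'n \<Rightarrow> complex^'n^'n" where
  "mat_exp A = (\<Sum>k. (1 / fact k) *\<^sub>R mat_pow A k)"

definition hermitian :: "complex^'n^'n \<Rightarrow> bool" where
  "hermitian A \<longleftrightarrow> map_matrix cnj (transpose A) = A"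

definition quartic_potential :: "complex^'n^'n \<Rightarrow> real \<Rightarrow> complex^'n^'n" where
  "quartic_potential \<alpha> x = x^2 *\<^sub>R \<alpha> + x^4 *\<^sub>R mat 1"

definition quartic_weight :: "complex^'n^'n \<Rightarrow> real \<Rightarrow> complex^'n^'n" where
  "quartic_weight \<alpha> x = mat_exp (- quartic_potential \<alpha> x)"

definition monic_matrix_poly :: "nat \<Rightarrow> (real \<Rightarrow> complex^'n^'n) \<Rightarrow> bool" where
  "monic_matrix_poly n p \<longleftrightarrow>
     (\<exists>\<gamma> :: nat \<Rightarrow> complex^'n^'n. \<forall>x. p x = x^n *\<^sub>R mat 1 + (\<Sum>k=1..n. x^(n - k) *\<^sub>R \<gamma> k))"

text \<open>
  Orthogonality is stated with \<open>has_bochner_integral\<close> so that the integrals are required to exist;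
  \<open>integral\<^sup>L\<close> alone is \<open>0\<close> for a non-integrable function.
\<close>

definition monic_mop ::
    "(real \<Rightarrow> complex^'n^'n) \<Rightarrow> nat \<Rightarrow> (real \<Rightarrow> complex^'n^'n) \<Rightarrow> bool" where
  "monic_mop \<rho> n p \<longleftrightarrow> monic_matrix_poly n p \<and>
     (\<forall>j<n. has_bochner_integral lborel (\<lambda>x. x^j *\<^sub>R (p x ** \<rho> x)) 0)"

text \<open>\<open>c_inv \<rho> P n\<close> is the matrix whose inverse is $c_n$.\<close>

definition c_inv ::
    "(real \<Rightarrow> complex^'n^'n) \<Rightarrow> (nat \<Rightarrow> real \<Rightarrow> complex^'n^'n) \<Rightarrow> nat \<Rightarrow> complex^'n^'n" where
  "c_inv \<rho> P n =
     map_matrix (\<lambda>z. - (1 / (2 * of_real pi * \<i>)) * z) (LINT x|lborel. x^n *\<^sub>R (P n x ** \<rho> x))"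

definition c_mat ::
    "(real \<Rightarrow> complex^'n^'n) \<Rightarrow> (nat \<Rightarrow> real \<Rightarrow> complex^'n^'n) \<Rightarrow> nat \<Rightarrow> complex^'n^'n" where
  "c_mat \<rho> P n = matrix_inv (c_inv \<rho> P n)"

definition beta_mat ::
    "(real \<Rightarrow> complex^'n^'n) \<Rightarrow> (nat \<Rightarrow> real \<Rightarrow> complex^'n^'n) \<Rightarrow> nat \<Rightarrow> complex^'n^'n" where
  "beta_mat \<rho> P n =
     (if n = 0 then 0 else 2 *\<^sub>R (matrix_inv (c_mat \<rho> P n) ** c_mat \<rho> P (n - 1)))"

end

theory Submission
  imports Defs "HOL-Probability.Sinc_Integral" "HOL-Real_Asymp.Real_Asymp"
begin

text \<open>
  The weight is positive definite because \<open>\<rho> x = M x ** M x\<close> with \<open>M x\<close> the (Hermitian,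
  invertible) exponential of half the exponent. Hence a polynomial of degree below \<open>n\<close> that is
  orthogonal to \<open>1, x, \<dots>, x\<^sup>n\<^sup>-\<^sup>1\<close> vanishes, which yields uniqueness of \<open>P n\<close>, its parity, and
  invertibility of \<open>h n = \<integral> P\<^sub>n \<rho> x\<^sup>n\<close>. Uniqueness also shows that \<open>P n\<close> and \<open>h n\<close> commute with every
  matrix commuting with \<open>\<alpha>\<close>, in particular with each other, so that the scalar argument applies:
  \<open>x P\<^sub>n = P\<^sub>n\<^sub>+\<^sub>1 + B\<^sub>n P\<^sub>n\<^sub>-\<^sub>1\<close> with \<open>B\<^sub>n = h\<^sub>n (h\<^sub>n\<^sub>-\<^sub>1)\<inverse>\<close>, and integrating \<open>(P\<^sub>n\<^sub>-\<^sub>1 \<rho> P\<^sub>n)'\<close> gives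
  \<open>n h\<^sub>n\<^sub>-\<^sub>1 = 2 h\<^sub>n \<alpha> + 4 (B\<^sub>n\<^sub>+\<^sub>1 + B\<^sub>n + B\<^sub>n\<^sub>-\<^sub>1) h\<^sub>n\<close>. Here \<open>\<beta>\<^sub>n = 2 B\<^sub>n\<close>.

  Identities for the exponential such as \<open>exp (A + s I) = e\<^sup>s exp A\<close> are read off from uniqueness for
  the differential equation \<open>Y' = A Y\<close>, since complex matrices carry no Banach algebra instance.
\<close>

section \<open>Calculus of the matrix product\<close>

text \<open>In finite dimension bilinearity already gives boundedness. The interpretation
  \<open>mm\<close> below then supplies limits, series, derivatives and integrals of
  products.\<close>

lemma bounded_bilinear_matrix_mult:
  "bounded_bilinear ((**) :: complex^'n^'n \<Rightarrow> complex^'n^'n \<Rightarrow> complex^'n^'n)"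
proof -
  have "linear (\<lambda>B :: complex^'n^'n. A ** B)" "linear (\<lambda>B :: complex^'n^'n. B ** A)" for A :: "complex^'n^'n"
    by (auto intro!: linearI simp: matrix_matrix_mult_def vec_eq_iff sum.distrib algebra_simps
        scaleR_sum_right)
  then show ?thesis
    by (simp add: bilinear_conv_bounded_bilinear [symmetric] bilinear_def)
qed

interpretation mm: bounded_bilinear
  "(**) :: complex^'n^'n \<Rightarrow> complex^'n^'n \<Rightarrow> complex^'n^'n"
  by (rule bounded_bilinear_matrix_mult)

section \<open>The matrix exponential\<close>

lemma mat_pow_scaleR: "mat_pow (t *\<^sub>R A) k = t ^ k *\<^sub>R mat_pow A k"
  by (induction k) (simp_all add: mm.scaleR_left mm.scaleR_right)

lemma mat_pow_commute: "K ** A = A ** K \<Longrightarrow> K ** mat_pow A k = mat_pow A k ** K"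
proof (induction k)
  case (Suc k)
  have "K ** mat_pow A (Suc k) = (K ** A) ** mat_pow A k"
    by (simp add: matrix_mul_assoc)
  also have "\<dots> = A ** (K ** mat_pow A k)"
    by (subst Suc.prems) (rule matrix_mul_assoc [symmetric])
  also have "\<dots> = mat_pow A (Suc k) ** K"
    by (subst Suc.IH[OF Suc.prems]) (simp add: matrix_mul_assoc)
  finally show ?case .
qed simp

text \<open>The constant \<open>K\<close> bounding the product plays the role of
  submultiplicativity, and \<open>C\<close> that of the norm of the identity. The series is then
  dominated by a scalar exponential series. The growth bound later shows that
  \<open>exp (- (x ^ 4))\<close> wins over the matrix factor of the weight.\<close>

lemma
  shows mat_exp_summable: "summable (\<lambda>k. norm ((1 / fact k) *\<^sub>R mat_pow (A :: complex^'n^'n) k))"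
    and norm_mat_exp_le: "\<exists>C K. \<forall>A :: complex^'n^'n. norm (mat_exp A) \<le> C * exp (K * norm A)"
proof -
  have "\<exists>K>0. \<forall>(A :: complex^'n^'n) (B :: complex^'n^'n). norm (A ** B) \<le> norm A * norm B * K"
    by (rule mm.pos_bounded)
  then obtain K where K: "K > 0"
    "\<And>(A :: complex^'n^'n) (B :: complex^'n^'n). norm (A ** B) \<le> norm A * norm B * K"
    by auto
  define C where "C = norm (mat 1 :: complex^'n^'n)"
  have pow: "norm (mat_pow A k) \<le> C * (K * norm A) ^ k" for A :: "complex^'n^'n" and k
  proof (induction k)
    case (Suc k)
    have "norm (mat_pow A (Suc k)) \<le> norm A * norm (mat_pow A k) * K"
      using K(2) by simp
    also have "\<dots> \<le> norm A * (C * (K * norm A) ^ k) * K"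
      using Suc K(1) by (intro mult_right_mono mult_left_mono) auto
    finally show ?case by (simp add: mult_ac)
  qed (simp add: C_def)
  have le: "norm ((1 / fact k) *\<^sub>R mat_pow A k) \<le> C * ((K * norm A) ^ k /\<^sub>R fact k)"
    for A :: "complex^'n^'n" and k
    using pow[of A k] by (simp add: field_simps)
  have sm: "(\<lambda>k. C * ((K * norm A) ^ k /\<^sub>R fact k)) sums (C * exp (K * norm A))"
    for A :: "complex^'n^'n"
    by (intro sums_mult) (rule exp_converges)
  show "summable (\<lambda>k. norm ((1 / fact k) *\<^sub>R mat_pow A k))"
    by (rule summable_comparison_test'[OF sums_summable[OF sm[of A]], of 0])
      (simp only: real_norm_def abs_norm_cancel le)
  have "norm (mat_exp A) \<le> C * exp (K * norm A)" for A :: "complex^'n^'n"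
    unfolding mat_exp_def sums_unique[OF sm[of A]]
    by (rule norm_suminf_le[OF le sums_summable[OF sm[of A]]])
  then show "\<exists>C K. \<forall>A :: complex^'n^'n. norm (mat_exp A) \<le> C * exp (K * norm A)" by auto
qed

lemma mat_exp_sums:
  fixes A :: "complex^'n^'n"
  shows "(\<lambda>k. (1 / fact k) *\<^sub>R mat_pow A k) sums mat_exp A"
  unfolding mat_exp_def
  by (intro summable_sums summable_norm_cancel[OF mat_exp_summable])

lemma mat_exp_0 [simp]: "mat_exp (0 :: complex^'n^'n) = mat 1"
proof -
  have "(\<lambda>k. (1 / fact k) *\<^sub>R mat_pow (0 :: complex^'n^'n) k) = (\<lambda>k. if k = 0 then mat 1 else 0)"
  proof
    fix k show "(1 / fact k) *\<^sub>R mat_pow (0 :: complex^'n^'n) k = (if k = 0 then mat 1 else 0)"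
      by (cases k) auto
  qed
  then have "(\<lambda>k. if k = 0 then mat 1 else 0) sums mat_exp (0 :: complex^'n^'n)"
    using mat_exp_sums[of "0 :: complex^'n^'n"] by simp
  then show ?thesis
    by (rule sums_unique2) (rule sums_single)
qed

lemma mat_exp_commute:
  fixes A K :: "complex^'n^'n"
  assumes "K ** A = A ** K"
  shows "K ** mat_exp A = mat_exp A ** K"
proof -
  have "(\<lambda>k. K ** ((1 / fact k) *\<^sub>R mat_pow A k)) sums (K ** mat_exp A)"
    by (rule mm.bounded_linear_right[THEN bounded_linear.sums, OF mat_exp_sums])
  moreover have "(\<lambda>k. ((1 / fact k) *\<^sub>R mat_pow A k) ** K) sums (mat_exp A ** K)"
    by (rule mm.bounded_linear_left[THEN bounded_linear.sums, OF mat_exp_sums])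
  ultimately show ?thesis
    using sums_unique2 by (simp add: mm.scaleR_left mm.scaleR_right mat_pow_commute[OF assms])
qed

text \<open>Taking the inner product with a basis element \<open>b\<close> leaves a real power
  series in \<open>t\<close> that converges everywhere, so it may be differentiated term by term.
  The shifted coefficients are those of \<open>A ** mat_exp (t *\<^sub>R A)\<close>.\<close>

lemma mat_exp_has_vector_derivative:
  fixes A :: "complex^'n^'n"
  shows "((\<lambda>t. mat_exp (t *\<^sub>R A)) has_vector_derivative A ** mat_exp (t *\<^sub>R A)) (at t within S)"
  unfolding has_vector_derivative_def
proof (subst has_derivative_componentwise_within, intro ballI)
  fix b :: "complex^'n^'n"
  define c where "c k = ((1 / fact k) *\<^sub>R mat_pow A k) \<bullet> b" for k
  have c: "(\<lambda>k. c k * t ^ k) sums (mat_exp (t *\<^sub>R A) \<bullet> b)" for t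
    using bounded_linear.sums[OF bounded_linear_inner_left mat_exp_sums[of "t *\<^sub>R A"], of b]
    by (simp add: c_def mat_pow_scaleR mult_ac)
  have "(\<lambda>k. diffs c k * t ^ k) sums ((A ** mat_exp (t *\<^sub>R A)) \<bullet> b)"
  proof -
    have "(\<lambda>k. (A ** ((1 / fact k) *\<^sub>R mat_pow (t *\<^sub>R A) k)) \<bullet> b) sums ((A ** mat_exp (t *\<^sub>R A)) \<bullet> b)"
      by (intro bounded_linear.sums[OF bounded_linear_inner_left]
          mm.bounded_linear_right[THEN bounded_linear.sums, OF mat_exp_sums])
    moreover have "(A ** ((1 / fact k) *\<^sub>R mat_pow (t *\<^sub>R A) k)) \<bullet> b = diffs c k * t ^ k" for k
      by (simp add: diffs_def c_def mat_pow_scaleR mm.scaleR_right del: of_nat_Suc)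
    ultimately show ?thesis by simp
  qed
  moreover have "((\<lambda>t. \<Sum>k. c k * t ^ k) has_field_derivative (\<Sum>k. diffs c k * t ^ k)) (at t)"
    using c by (intro termdiffs_strong_converges_everywhere) (auto simp: sums_iff)
  ultimately have "((\<lambda>t. mat_exp (t *\<^sub>R A) \<bullet> b) has_real_derivative ((A ** mat_exp (t *\<^sub>R A)) \<bullet> b)) (at t)"
    using c by (simp add: sums_iff)
  then show "((\<lambda>t. mat_exp (t *\<^sub>R A) \<bullet> b) has_derivative
      (\<lambda>h. (h *\<^sub>R (A ** mat_exp (t *\<^sub>R A))) \<bullet> b)) (at t within S)"
    by (simp add: has_field_derivative_def mult_commute_abs has_derivative_at_withinI)
qed

lemma has_vector_derivative_zero_eq:
  fixes f :: "real \<Rightarrow> 'a::real_normed_vector"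
  assumes "\<And>t. (f has_vector_derivative 0) (at t)"
  shows "f s = f t"
  using has_vector_derivative_zero_constant[OF convex_UNIV, of f] assms by (metis UNIV_I)

lemma mat_exp_minus_left:
  fixes A :: "complex^'n^'n"
  shows "mat_exp (- A) ** mat_exp A = mat 1"
proof -
  have "((\<lambda>t. mat_exp (t *\<^sub>R - A) ** mat_exp (t *\<^sub>R A)) has_vector_derivative 0) (at t)" for t
  proof -
    have "((\<lambda>t. mat_exp (t *\<^sub>R - A) ** mat_exp (t *\<^sub>R A)) has_vector_derivative
      mat_exp (t *\<^sub>R - A) ** (A ** mat_exp (t *\<^sub>R A)) + (- A ** mat_exp (t *\<^sub>R - A)) ** mat_exp (t *\<^sub>R A)) (at t)"
      by (intro mm.has_vector_derivative mat_exp_has_vector_derivative)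
    moreover have "A ** mat_exp (t *\<^sub>R - A) = mat_exp (t *\<^sub>R - A) ** A"
      by (intro mat_exp_commute) (simp add: mm.scaleR_left mm.scaleR_right mm.minus_left mm.minus_right)
    ultimately show ?thesis
      by (simp add: mm.minus_left matrix_mul_assoc)
  qed
  from has_vector_derivative_zero_eq[OF this, of 1 0] show ?thesis by simp
qed

text \<open>The integrating factor \<open>mat_exp (t *\<^sub>R - A)\<close> makes the product with
  \<open>Y t\<close> constant, because \<open>A\<close> commutes with its own exponential.
  Multiplying by the inverse factor recovers \<open>Y t\<close>.\<close>

lemma mat_exp_ode_unique:
  fixes A :: "complex^'n^'n"
  assumes Y: "\<And>t. (Y has_vector_derivative A ** Y t) (at t)" and "Y 0 = mat 1"
  shows "Y t = mat_exp (t *\<^sub>R A)"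
proof -
  have "((\<lambda>t. mat_exp (t *\<^sub>R - A) ** Y t) has_vector_derivative 0) (at t)" for t
  proof -
    have "((\<lambda>t. mat_exp (t *\<^sub>R - A) ** Y t) has_vector_derivative
      mat_exp (t *\<^sub>R - A) ** (A ** Y t) + (- A ** mat_exp (t *\<^sub>R - A)) ** Y t) (at t)"
      by (intro mm.has_vector_derivative mat_exp_has_vector_derivative Y)
    moreover have "A ** mat_exp (t *\<^sub>R - A) = mat_exp (t *\<^sub>R - A) ** A"
      by (intro mat_exp_commute) (simp add: mm.scaleR_left mm.scaleR_right mm.minus_left mm.minus_right)
    ultimately show ?thesis
      by (simp add: mm.minus_left matrix_mul_assoc)
  qed
  from has_vector_derivative_zero_eq[OF this, of t 0]
  have "mat_exp (- (t *\<^sub>R A)) ** Y t = mat 1" by (simp add: assms)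
  then have "mat_exp (t *\<^sub>R A) ** (mat_exp (- (t *\<^sub>R A)) ** Y t) = mat_exp (t *\<^sub>R A)" by simp
  then show ?thesis
    using mat_exp_minus_left[of "- (t *\<^sub>R A)"] by (simp add: matrix_mul_assoc)
qed

lemma mat_exp_half:
  fixes A :: "complex^'n^'n"
  shows "mat_exp ((1/2) *\<^sub>R A) ** mat_exp ((1/2) *\<^sub>R A) = mat_exp A"
proof -
  let ?E = "\<lambda>t. mat_exp (t *\<^sub>R ((1/2) *\<^sub>R A))"
  have "((\<lambda>t. ?E t ** ?E t) has_vector_derivative A ** (?E t ** ?E t)) (at t)" for t
  proof -
    have "((\<lambda>t. ?E t ** ?E t) has_vector_derivative
        ?E t ** ((1/2) *\<^sub>R A ** ?E t) + ((1/2) *\<^sub>R A ** ?E t) ** ?E t) (at t)"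
      by (intro mm.has_vector_derivative mat_exp_has_vector_derivative)
    moreover have "A ** ?E t = ?E t ** A"
      by (intro mat_exp_commute) (simp add: mm.scaleR_left mm.scaleR_right)
    ultimately show ?thesis
      by (simp add: mm.scaleR_left mm.scaleR_right matrix_mul_assoc flip: scaleR_add_left)
  qed
  from mat_exp_ode_unique[of "\<lambda>t. ?E t ** ?E t" A 1, OF this] show ?thesis by simp
qed

lemma mat_exp_add_scalar:
  fixes A :: "complex^'n^'n"
  shows "mat_exp (A + s *\<^sub>R mat 1) = exp s *\<^sub>R mat_exp A"
proof -
  let ?B = "A + s *\<^sub>R mat 1"
  \<comment> \<open>The scalar factor cancels the contribution of \<open>s *\<^sub>R mat 1\<close>
    to the derivative, so this curve solves the equation for \<open>A\<close> alone.\<close>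
  have "((\<lambda>t. exp (t * (- s)) *\<^sub>R mat_exp (t *\<^sub>R ?B)) has_vector_derivative
      A ** (exp (t * (- s)) *\<^sub>R mat_exp (t *\<^sub>R ?B))) (at t)" for t
  proof -
    have "((\<lambda>t. exp (t * (- s))) has_real_derivative exp (t * (- s)) * (- s)) (at t)"
      by (auto intro!: derivative_eq_intros)
    from has_vector_derivative_scaleR[OF this mat_exp_has_vector_derivative[of ?B t UNIV]]
    show ?thesis
      by (simp add: mm.scaleR_right mm.add_left mm.scaleR_left algebra_simps)
  qed
  from mat_exp_ode_unique[of "\<lambda>t. exp (t * (- s)) *\<^sub>R mat_exp (t *\<^sub>R ?B)" A 1, OF this]
  have "exp (- s) *\<^sub>R mat_exp ?B = mat_exp A" by simp
  then have "exp s *\<^sub>R (exp (- s) *\<^sub>R mat_exp ?B) = exp s *\<^sub>R mat_exp A" by simp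
  then show ?thesis by (simp flip: exp_add)
qed

section \<open>Conjugate transposes\<close>

definition adj :: "complex^'n^'n \<Rightarrow> complex^'n^'n" where
  "adj A = map_matrix cnj (transpose A)"

lemma adj_mult: "adj (A ** B) = adj B ** adj A"
  by (simp add: adj_def vec_eq_iff matrix_matrix_mult_def transpose_def mult.commute)

lemma adj_mat_1 [simp]: "adj (mat 1) = mat 1"
  by (auto simp: adj_def vec_eq_iff transpose_def mat_def)

lemma bounded_linear_adj: "bounded_linear (adj :: complex^'n^'n \<Rightarrow> complex^'n^'n)"
  unfolding linear_conv_bounded_linear [symmetric]
  by (auto intro!: linearI simp: adj_def vec_eq_iff transpose_def)

lemma adj_scaleR: "adj (r *\<^sub>R A) = r *\<^sub>R adj A"
  by (simp add: adj_def vec_eq_iff transpose_def)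

lemma adj_0: "adj 0 = 0"
  by (simp add: adj_def vec_eq_iff transpose_def)

lemma adj_add: "adj (A + B) = adj A + adj B"
  by (simp add: adj_def vec_eq_iff transpose_def)

lemma adj_minus: "adj (- A) = - adj A"
  by (simp add: adj_def vec_eq_iff transpose_def)

lemma adj_mat_exp:
  fixes A :: "complex^'n^'n"
  assumes "adj A = A"
  shows "adj (mat_exp A) = mat_exp A"
proof -
  have "adj (mat_pow A k) = mat_pow A k" for k
    by (induction k) (simp_all add: adj_mult assms mat_pow_commute)
  moreover have "(\<lambda>k. adj ((1 / fact k) *\<^sub>R mat_pow A k)) sums adj (mat_exp A)"
    by (rule bounded_linear.sums[OF bounded_linear_adj mat_exp_sums])
  ultimately have "(\<lambda>k. (1 / fact k) *\<^sub>R mat_pow A k) sums adj (mat_exp A)"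
    by (simp add: adj_scaleR)
  with mat_exp_sums show ?thesis by (metis sums_unique2)
qed

section \<open>The quartic weight\<close>

text \<open>The quartic term is a multiple of the identity and splits off as a scalar, which carries
  all the decay. What remains is the exponential flow of \<open>- \<alpha>\<close> at time
  \<open>x\<^sup>2\<close>, to which the chain rule applies.\<close>

lemma quartic_weight_eq:
  "quartic_weight \<alpha> x = exp (- (x ^ 4)) *\<^sub>R mat_exp (x\<^sup>2 *\<^sub>R (- \<alpha>))"
proof -
  have "- quartic_potential \<alpha> x = x\<^sup>2 *\<^sub>R (- \<alpha>) + (- (x ^ 4)) *\<^sub>R mat 1"
    by (simp add: quartic_potential_def)
  then show ?thesis by (simp only: quartic_weight_def mat_exp_add_scalar)
qed

lemma quartic_weight_minus: "quartic_weight \<alpha> (- x) = quartic_weight \<alpha> x"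
  by (simp add: quartic_weight_def quartic_potential_def)

lemma quartic_weight_commute:
  assumes "K ** \<alpha> = \<alpha> ** K"
  shows "K ** quartic_weight \<alpha> x = quartic_weight \<alpha> x ** K"
proof -
  have "K ** mat_exp (x\<^sup>2 *\<^sub>R (- \<alpha>)) = mat_exp (x\<^sup>2 *\<^sub>R (- \<alpha>)) ** K"
    by (intro mat_exp_commute)
      (simp add: assms mm.scaleR_left mm.scaleR_right mm.minus_left mm.minus_right)
  then show ?thesis
    by (simp add: quartic_weight_eq mm.scaleR_left mm.scaleR_right)
qed

lemma quartic_weight_has_vector_derivative:
  "(quartic_weight \<alpha> has_vector_derivative
     - ((2 * x) *\<^sub>R (\<alpha> ** quartic_weight \<alpha> x) + (4 * x ^ 3) *\<^sub>R quartic_weight \<alpha> x)) (at x)"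
proof -
  have "((\<lambda>x. x\<^sup>2) has_vector_derivative 2 * x) (at x)"
    unfolding has_real_derivative_iff_has_vector_derivative [symmetric]
    by (auto intro!: derivative_eq_intros)
  from vector_diff_chain_at[OF this mat_exp_has_vector_derivative[of "- \<alpha>"]]
  have E: "((\<lambda>x. mat_exp (x\<^sup>2 *\<^sub>R (- \<alpha>))) has_vector_derivative
      (2 * x) *\<^sub>R (- \<alpha> ** mat_exp (x\<^sup>2 *\<^sub>R (- \<alpha>)))) (at x)"
    by (simp only: o_def)
  have "((\<lambda>x. exp (- (x ^ 4))) has_real_derivative exp (- (x ^ 4)) * - (4 * x ^ 3)) (at x)"
    by (auto intro!: derivative_eq_intros)
  from has_vector_derivative_scaleR[OF this E] show ?thesis
    unfolding quartic_weight_eq [abs_def]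
    by (simp add: mm.minus_left mm.scaleR_right mult_ac)
qed

lemma continuous_quartic_weight [continuous_intros]: "continuous_on S (quartic_weight \<alpha>)"
  by (meson quartic_weight_has_vector_derivative has_vector_derivative_continuous
      continuous_at_imp_continuous_on)

section \<open>Decay and integrability of the weight\<close>

text \<open>With m = k + 1, both factors of \<open>\<bar>x\<bar> ^ k * (1 + x\<^sup>2)\<close> are
  absorbed into \<open>(1 + x\<^sup>2) ^ m\<close>, and
  \<open>(1 + x\<^sup>2 / m) ^ m \<le> exp (x\<^sup>2)\<close> bounds that power up to the factor
  \<open>m ^ m\<close>.\<close>

lemma power_mult_exp_minus_square_le:
  fixes x :: real
  shows "\<bar>x\<bar> ^ k * exp (- x\<^sup>2) \<le> real (Suc k) ^ Suc k / (1 + x\<^sup>2)"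
proof -
  let ?m = "Suc k"
  have pos: "1 + x\<^sup>2 > 0" by (simp add: add_pos_nonneg)
  have "\<bar>x\<bar> \<le> 1 + x\<^sup>2"
    using sum_squares_bound[of "\<bar>x\<bar>" 1] by (simp add: abs_if split: if_splits)
  then have 1: "\<bar>x\<bar> ^ k \<le> (1 + x\<^sup>2) ^ k" by (intro power_mono) auto
  have "(1 + x\<^sup>2) / real ?m \<le> 1 + x\<^sup>2 / real ?m"
    by (simp add: field_simps)
  then have "((1 + x\<^sup>2) / real ?m) ^ ?m \<le> (1 + x\<^sup>2 / real ?m) ^ ?m"
    using pos by (intro power_mono) auto
  also have "\<dots> \<le> exp (x\<^sup>2)"
    by (rule exp_ge_one_plus_x_over_n_power_n) (auto intro: order_trans[of _ 0])
  finally have 2: "(1 + x\<^sup>2) ^ ?m \<le> exp (x\<^sup>2) * real ?m ^ ?m"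
    by (simp add: power_divide pos_divide_le_eq del: power_Suc of_nat_Suc)
  have "\<bar>x\<bar> ^ k * (1 + x\<^sup>2) \<le> (1 + x\<^sup>2) ^ ?m"
    using 1 pos by (simp add: mult.commute)
  with 2 have "\<bar>x\<bar> ^ k * (1 + x\<^sup>2) \<le> exp (x\<^sup>2) * real ?m ^ ?m" by linarith
  then show ?thesis
    using pos by (simp add: exp_minus field_simps del: power_Suc of_nat_Suc)
qed

text \<open>The majorant \<open>C / (1 + x\<^sup>2)\<close> serves twice: it is integrable over the
  line and it tends to 0 at both ends.\<close>

lemma quartic_weight_decay:
  "\<exists>C. \<forall>x. norm (x ^ k *\<^sub>R quartic_weight \<alpha> x) \<le> C / (1 + x\<^sup>2)"
proof -
  obtain C K where CK: "\<And>A :: complex^'a^'a. norm (mat_exp A) \<le> C * exp (K * norm A)"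
    using norm_mat_exp_le by metis
  have "0 \<le> norm (mat_exp (0 :: complex^'a^'a))" by simp
  also have "\<dots> \<le> C" using CK[of 0] by simp
  finally have C: "C \<ge> 0" .
  define L where "L = K * norm \<alpha>"
  \<comment> \<open>The exponent \<open>(L + 1)\<^sup>2 / 4\<close> is the maximum of
    \<open>(L + 1) * t - t\<^sup>2\<close> over real \<open>t\<close>. At
    \<open>t = x\<^sup>2\<close>, completing the square bounds \<open>L * x\<^sup>2 - x ^ 4\<close>
    by this maximum minus \<open>x\<^sup>2\<close>.\<close>
  define D where "D = exp ((L + 1)\<^sup>2 / 4)"
  have "norm (x ^ k *\<^sub>R quartic_weight \<alpha> x) \<le> C * D * (real (Suc k) ^ Suc k) / (1 + x\<^sup>2)" for x
  proof -
    have "norm (mat_exp (x\<^sup>2 *\<^sub>R (- \<alpha>))) \<le> C * exp (L * x\<^sup>2)"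
      using CK[of "x\<^sup>2 *\<^sub>R (- \<alpha>)"] by (simp add: L_def mult_ac)
    then have "norm (x ^ k *\<^sub>R quartic_weight \<alpha> x) \<le> \<bar>x\<bar> ^ k * (exp (- (x ^ 4)) * (C * exp (L * x\<^sup>2)))"
      unfolding quartic_weight_eq norm_scaleR power_abs abs_exp_cancel by (intro mult_left_mono) auto
    also have "\<dots> = C * (\<bar>x\<bar> ^ k * exp (L * x\<^sup>2 - x ^ 4))"
      by (simp add: mult_ac exp_diff exp_minus field_simps)
    also have "\<dots> \<le> C * (\<bar>x\<bar> ^ k * (D * exp (- x\<^sup>2)))"
    proof -
      have "0 \<le> (x\<^sup>2 - (L + 1) / 2)\<^sup>2" by simp
      also have "\<dots> = x ^ 4 - (L + 1) * x\<^sup>2 + (L + 1)\<^sup>2 / 4"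
        by (simp add: power2_eq_square power4_eq_xxxx field_simps)
      finally have "exp (L * x\<^sup>2 - x ^ 4) \<le> D * exp (- x\<^sup>2)"
        unfolding D_def exp_add [symmetric] by (simp add: algebra_simps)
      then show ?thesis using C by (intro mult_left_mono) auto
    qed
    also have "\<dots> \<le> C * D * (real (Suc k) ^ Suc k / (1 + x\<^sup>2))"
      using mult_left_mono[OF power_mult_exp_minus_square_le[of x k], of "C * D"] C
      by (simp add: D_def mult_ac del: power_Suc of_nat_Suc)
    finally show ?thesis by simp
  qed
  then show ?thesis by blast
qed

lemma integrable_inverse_1_plus_square_UNIV: "integrable lborel (\<lambda>x::real. C / (1 + x\<^sup>2))"
proof -
  have "integrable lborel (\<lambda>x::real. inverse (1 + x\<^sup>2))"
    using integrable_inverse_1_plus_square by (simp add: set_integrable_def)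
  then show ?thesis by (simp add: divide_inverse)
qed

lemma integrable_quartic_weight: "integrable lborel (\<lambda>x. x ^ k *\<^sub>R quartic_weight \<alpha> x)"
proof -
  obtain C where C: "\<And>x. norm (x ^ k *\<^sub>R quartic_weight \<alpha> x) \<le> C / (1 + x\<^sup>2)"
    using quartic_weight_decay by metis
  show ?thesis
  proof (rule Bochner_Integration.integrable_bound[OF integrable_inverse_1_plus_square_UNIV[of C]])
    show "(\<lambda>x. x ^ k *\<^sub>R quartic_weight \<alpha> x) \<in> borel_measurable lborel"
      by (auto intro!: borel_measurable_continuous_onI continuous_intros)
    show "AE x in lborel. norm (x ^ k *\<^sub>R quartic_weight \<alpha> x) \<le> norm (C / (1 + x\<^sup>2))"
      unfolding real_norm_def by (intro always_eventually allI order_trans[OF C abs_ge_self])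
  qed
qed

lemma tendsto_quartic_weight:
  assumes "F = at_top \<or> F = at_bot"
  shows "((\<lambda>x. x ^ k *\<^sub>R quartic_weight \<alpha> x) \<longlongrightarrow> 0) F"
proof -
  obtain C where C: "\<And>x. norm (x ^ k *\<^sub>R quartic_weight \<alpha> x) \<le> C / (1 + x\<^sup>2)"
    using quartic_weight_decay by metis
  have "((\<lambda>x. C / (1 + x\<^sup>2)) \<longlongrightarrow> 0) F"
    using assms by (elim disjE; hypsubst; real_asymp)
  then show ?thesis
    by (rule Lim_null_comparison[OF always_eventually, rotated]) (intro allI C)
qed

section \<open>Positive definiteness of the weight\<close>

text \<open>With the Hermitian root \<open>M x\<close> of the weight, the integrand is
  \<open>R x ** adj (R x)\<close>. The real part \<open>T\<close> of its trace is the sum of the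
  squared moduli of the entries of \<open>R x\<close>, so a vanishing integral of a continuous
  nonnegative function forces \<open>R\<close> to vanish, and \<open>M x\<close> can be
  cancelled.\<close>

lemma integral_quartic_weight_adj_eq_0:
  fixes Q :: "real \<Rightarrow> complex^'n^'n"
  assumes "hermitian \<alpha>" and Q: "continuous_on UNIV Q"
    and int: "has_bochner_integral lborel (\<lambda>x. Q x ** quartic_weight \<alpha> x ** adj (Q x)) 0"
  shows "Q x = 0"
proof -
  define M where "M x = exp (- (x ^ 4) / 2) *\<^sub>R mat_exp ((1/2) *\<^sub>R (x\<^sup>2 *\<^sub>R (- \<alpha>)))" for x
  have MM: "M x ** M x = quartic_weight \<alpha> x" for x
    unfolding M_def quartic_weight_eq mm.scaleR_left mm.scaleR_right mat_exp_half
    by (simp flip: exp_add)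
  have adjM: "adj (M x) = M x" for x
  proof -
    have "adj ((1/2) *\<^sub>R (x\<^sup>2 *\<^sub>R (- \<alpha>))) = (1/2) *\<^sub>R (x\<^sup>2 *\<^sub>R (- \<alpha>))"
      using assms(1) by (simp add: adj_def [symmetric] hermitian_def adj_scaleR adj_minus)
    then show ?thesis by (simp add: M_def adj_scaleR adj_mat_exp)
  qed
  define R where "R x = Q x ** M x" for x
  have RR: "Q x ** quartic_weight \<alpha> x ** adj (Q x) = R x ** adj (R x)" for x
    by (simp add: R_def adj_mult adjM matrix_mul_assoc flip: MM)
  define T :: "complex^'n^'n \<Rightarrow> real" where "T A = (\<Sum>i\<in>UNIV. Re (A $ i $ i))" for A
  have T: "bounded_linear T"
    unfolding linear_conv_bounded_linear [symmetric] T_def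
    by (auto intro!: linearI simp: sum.distrib sum_distrib_left)
  have TR: "T (R x ** adj (R x)) = (\<Sum>i\<in>UNIV. \<Sum>j\<in>UNIV. (cmod (R x $ i $ j))\<^sup>2)" for x
    by (simp add: T_def matrix_matrix_mult_def adj_def transpose_def complex_norm_square [symmetric] del: of_real_power)
  have cont: "continuous_on UNIV (\<lambda>x. T (R x ** adj (R x)))"
  proof -
    have "continuous_on UNIV (\<lambda>x. mat_exp (t x *\<^sub>R A))" if "continuous_on UNIV t"
      for t :: "real \<Rightarrow> real" and A :: "complex^'n^'n"
    proof -
      have "continuous_on UNIV (\<lambda>t. mat_exp (t *\<^sub>R A))"
        unfolding continuous_on_eq_continuous_within
        by (intro ballI has_vector_derivative_continuous[OF mat_exp_has_vector_derivative])
      from continuous_on_compose2[OF this that] show ?thesis by simp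
    qed
    from this[of "\<lambda>x. (1/2) * x\<^sup>2" "- \<alpha>"]
    have "continuous_on UNIV (\<lambda>x. mat_exp ((1/2) *\<^sub>R (x\<^sup>2 *\<^sub>R (- \<alpha>))))"
      by (simp add: continuous_intros)
    then have "continuous_on UNIV R"
      unfolding R_def M_def by (intro mm.continuous_on continuous_intros Q) auto
    then show ?thesis
      by (intro bounded_linear.continuous_on[OF T] mm.continuous_on bounded_linear.continuous_on[OF bounded_linear_adj])
  qed
  have "has_bochner_integral lborel (\<lambda>x. T (R x ** adj (R x))) 0"
    using has_bochner_integral_bounded_linear[OF T int] bounded_linear.linear[OF T]
    by (simp add: RR linear_0)
  then have "AE x in lborel. T (R x ** adj (R x)) = 0"
    by (subst integral_nonneg_eq_0_iff_AE [symmetric])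
      (auto simp: has_bochner_integral_iff TR intro!: sum_nonneg)
  \<comment> \<open>From almost everywhere to everywhere: by continuity the zero set is closed, and
    a closed set of full measure contains every point.\<close>
  then have "x \<in> {x. T (R x ** adj (R x)) = 0}"
    by (intro mem_closed_if_AE_lebesgue AE_completion)
      (auto intro: closed_Collect_eq cont)
  then have "R x = 0"
    by (simp add: TR sum_nonneg_eq_0_iff sum_nonneg vec_eq_iff)
  \<comment> \<open>A right inverse of \<open>M x\<close>, obtained by negating both
    exponents.\<close>
  moreover have "M x ** (exp (x ^ 4 / 2) *\<^sub>R mat_exp (- ((1/2) *\<^sub>R (x\<^sup>2 *\<^sub>R (- \<alpha>))))) = mat 1"
    using mat_exp_minus_left[of "- ((1/2) *\<^sub>R (x\<^sup>2 *\<^sub>R (- \<alpha>)))"]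
    by (simp add: M_def mm.scaleR_left mm.scaleR_right flip: exp_add)
  ultimately show ?thesis
    by (metis R_def matrix_mul_assoc matrix_mul_rid mm.zero_left)
qed

section \<open>Inverses\<close>

text \<open>\<open>matrix_inv\<close> is defined by choice. The existence of \<open>B\<close> makes
  the choice meaningful, and uniqueness of two-sided inverses identifies it with
  \<open>B\<close>.\<close>

lemma matrix_inv_eqI:
  fixes A B :: "'a::semiring_1^'n^'n"
  assumes "A ** B = mat 1" "B ** A = mat 1"
  shows "matrix_inv A = B"
proof -
  have "A ** matrix_inv A = mat 1 \<and> matrix_inv A ** A = mat 1"
    unfolding matrix_inv_def by (rule someI[of _ B]) (use assms in auto)
  then show ?thesis
    by (metis assms(2) matrix_mul_assoc matrix_mul_lid matrix_mul_rid)
qed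

lemma
  fixes A :: "'a::semiring_1^'n^'n"
  assumes "invertible A"
  shows matrix_mul_matrix_inv: "A ** matrix_inv A = mat 1"
    and matrix_inv_matrix_mul: "matrix_inv A ** A = mat 1"
  using assms matrix_inv_eqI[of A] by (auto simp: invertible_def)

lemma matrix_inv_commute:
  fixes A K :: "'a::semiring_1^'n^'n"
  assumes "invertible A" "K ** A = A ** K"
  shows "K ** matrix_inv A = matrix_inv A ** K"
proof -
  have "K ** matrix_inv A = matrix_inv A ** (A ** K) ** matrix_inv A"
    by (simp add: matrix_mul_assoc matrix_inv_matrix_mul[OF assms(1)])
  also have "\<dots> = matrix_inv A ** K ** (A ** matrix_inv A)"
    by (simp only: assms(2) [symmetric] matrix_mul_assoc)
  finally show ?thesis by (simp add: matrix_mul_matrix_inv[OF assms(1)])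
qed

lemma invertible_if_left_kernel_trivial:
  fixes A :: "'a::field^'n^'n"
  assumes "\<And>K :: 'a^'n^'n. K ** A = 0 \<Longrightarrow> K = 0"
  shows "invertible A"
proof -
  have "x = 0" if "transpose A *v x = 0" for x
  proof -
    \<comment> \<open>All rows of \<open>K\<close> equal \<open>x\<close>, which turns a vector
      annihilated by the transpose into a matrix annihilating \<open>A\<close> from the
      left.\<close>
    define K :: "'a^'n^'n" where "K = (\<chi> i. x)"
    have "K ** A = 0"
      using that by (simp add: K_def vec_eq_iff matrix_matrix_mult_def matrix_vector_mult_def
          transpose_def mult.commute)
    then have "K = 0" by (rule assms)
    then show "x = 0" by (simp add: K_def vec_eq_iff)
  qed
  then have "\<exists>B. B ** transpose A = mat 1"
    by (simp add: matrix_left_invertible_ker)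
  then obtain B where "B ** transpose A = mat 1" ..
  then have "A ** transpose B = mat 1"
    by (metis matrix_transpose_mul transpose_transpose transpose_mat)
  then show ?thesis
    using matrix_left_right_inverse invertible_def by blast
qed

lemma matrix_mult_map_matrix_scale:
  fixes A B :: "'a::comm_ring_1^'n^'n"
  shows "map_matrix (\<lambda>z. s * z) A ** map_matrix (\<lambda>z. t * z) B = map_matrix (\<lambda>z. (s * t) * z) (A ** B)"
  by (simp add: vec_eq_iff matrix_matrix_mult_def sum_distrib_left mult_ac)

section \<open>Matrix polynomials\<close>

text \<open>The strict bound matches the orthogonality range \<open>j < n\<close>, and for
  \<open>n = 0\<close> only the zero function qualifies.\<close>

definition poly_below :: "nat \<Rightarrow> (real \<Rightarrow> complex^'n^'n) \<Rightarrow> bool" where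
  "poly_below n F \<longleftrightarrow> (\<exists>q. \<forall>x. F x = (\<Sum>k<n. x ^ k *\<^sub>R q k))"

text \<open>Additive properties of matrix polynomials need checking only on monomials with a matrix
  coefficient.\<close>

lemma poly_below_induct [consumes 1, case_names zero monom add]:
  assumes "poly_below n F"
    and "\<Phi> (\<lambda>_. 0)"
    and "\<And>k C. k < n \<Longrightarrow> \<Phi> (\<lambda>x. x ^ k *\<^sub>R C)"
    and "\<And>F G. \<Phi> F \<Longrightarrow> \<Phi> G \<Longrightarrow> \<Phi> (\<lambda>x. F x + G x)"
  shows "\<Phi> F"
proof -
  obtain q where q: "\<And>x. F x = (\<Sum>k<n. x ^ k *\<^sub>R q k)"
    using assms(1) unfolding poly_below_def by metis
  have "\<Phi> (\<lambda>x. \<Sum>k<m. x ^ k *\<^sub>R q k)" if "m \<le> n" for m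
    using that
  proof (induction m)
    case (Suc m)
    then show ?case using assms(4)[OF Suc.IH assms(3)[of m "q m"]] by simp
  qed (simp add: assms)
  then have "\<Phi> (\<lambda>x. \<Sum>k<n. x ^ k *\<^sub>R q k)" by simp
  also have "(\<lambda>x. \<Sum>k<n. x ^ k *\<^sub>R q k) = F" using q by (intro ext) simp
  finally show ?thesis .
qed

lemma poly_below_0: "poly_below n (\<lambda>_. 0)"
  unfolding poly_below_def by (intro exI[of _ "\<lambda>_. 0"]) simp

lemma poly_below_add:
  assumes "poly_below n F" "poly_below n G"
  shows "poly_below n (\<lambda>x. F x + G x)"
proof -
  obtain q r where "\<And>x. F x = (\<Sum>k<n. x ^ k *\<^sub>R q k)" "\<And>x. G x = (\<Sum>k<n. x ^ k *\<^sub>R r k)"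
    using assms unfolding poly_below_def by metis
  then show ?thesis
    unfolding poly_below_def
    by (intro exI[of _ "\<lambda>k. q k + r k"]) (simp add: sum.distrib scaleR_add_right)
qed

lemma poly_below_monom:
  assumes "k < n"
  shows "poly_below n (\<lambda>x. x ^ k *\<^sub>R C)"
proof -
  have "x ^ k *\<^sub>R C = (\<Sum>i<n. x ^ i *\<^sub>R (if i = k then C else 0))" for x :: real
  proof -
    have "(\<Sum>i<n. x ^ i *\<^sub>R (if i = k then C else 0)) = (\<Sum>i<n. if i = k then x ^ k *\<^sub>R C else 0)"
      by (intro sum.cong) auto
    then show ?thesis using assms by (simp add: sum.delta)
  qed
  then show ?thesis
    unfolding poly_below_def by (intro exI[of _ "\<lambda>i. if i = k then C else 0"]) simp
qed

lemma poly_below_mono: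
  assumes "poly_below n F" "n \<le> m"
  shows "poly_below m F"
  using assms(1)
  by (induction rule: poly_below_induct)
    (use assms(2) in \<open>auto intro: poly_below_0 poly_below_monom poly_below_add\<close>)

lemma poly_below_lmult: "poly_below n F \<Longrightarrow> poly_below n (\<lambda>x. K ** F x)"
  by (induction rule: poly_below_induct)
    (auto simp: mm.zero_right mm.scaleR_right mm.add_right
      intro: poly_below_0 poly_below_monom poly_below_add)

lemma poly_below_rmult: "poly_below n F \<Longrightarrow> poly_below n (\<lambda>x. F x ** K)"
  by (induction rule: poly_below_induct)
    (auto simp: mm.zero_left mm.scaleR_left mm.add_left
      intro: poly_below_0 poly_below_monom poly_below_add)

lemma poly_below_uminus: "poly_below n F \<Longrightarrow> poly_below n (\<lambda>x. - F x)"
  using poly_below_lmult[of n F "- mat 1"] by (simp add: mm.minus_left)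

lemma poly_below_diff:
  assumes "poly_below n F" "poly_below n G"
  shows "poly_below n (\<lambda>x. F x - G x)"
  using poly_below_add[OF assms(1) poly_below_uminus[OF assms(2)]] by simp

lemma poly_below_scale_power: "poly_below n F \<Longrightarrow> poly_below (n + j) (\<lambda>x. x ^ j *\<^sub>R F x)"
proof (induction rule: poly_below_induct)
  case (monom k C)
  then show ?case using poly_below_monom[of "j + k" "n + j" C] by (simp add: power_add)
qed (auto simp: scaleR_add_right intro: poly_below_0 poly_below_add)

lemma poly_below_scale: "poly_below n F \<Longrightarrow> poly_below (Suc n) (\<lambda>x. x *\<^sub>R F x)"
  using poly_below_scale_power[of n F 1] by simp

lemma poly_below_adj: "poly_below n F \<Longrightarrow> poly_below n (\<lambda>x. adj (F x))"
  by (induction rule: poly_below_induct)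
    (simp_all add: adj_0 adj_scaleR adj_add poly_below_0 poly_below_monom poly_below_add)

lemma poly_below_reflect: "poly_below n F \<Longrightarrow> poly_below n (\<lambda>x. F (- x))"
proof (induction rule: poly_below_induct)
  case (monom k C)
  have "poly_below n (\<lambda>x. x ^ k *\<^sub>R ((- 1) ^ k *\<^sub>R C))"
    using monom by (rule poly_below_monom)
  moreover have "(\<lambda>x. x ^ k *\<^sub>R ((- 1) ^ k *\<^sub>R C)) = (\<lambda>x. (- x) ^ k *\<^sub>R C)"
  proof
    fix x :: real
    show "x ^ k *\<^sub>R ((- 1) ^ k *\<^sub>R C) = (- x) ^ k *\<^sub>R C"
      by (simp only: power_minus[of x] scaleR_scaleR mult.commute)
  qed
  ultimately show ?case
    by (rule back_subst[of "poly_below n"])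
qed (auto intro: poly_below_0 poly_below_add)

lemma poly_below_derivative:
  assumes "poly_below n F"
  shows "\<exists>F'. poly_below (n - 1) F' \<and> (\<forall>x. (F has_vector_derivative F' x) (at x))"
  using assms
proof (induction rule: poly_below_induct)
  case zero
  show ?case by (intro exI[of _ "\<lambda>_. 0"]) (auto intro: poly_below_0)
next
  case (monom k C)
  have "((\<lambda>x. x ^ k *\<^sub>R C) has_vector_derivative x ^ (k - 1) *\<^sub>R (real k *\<^sub>R C)) (at x)" for x
  proof -
    have "((\<lambda>x. x ^ k) has_real_derivative real k * x ^ (k - 1)) (at x)"
      using DERIV_pow[of k x UNIV] by simp
    from has_vector_derivative_scaleR[OF this has_vector_derivative_const[of C]]
    show ?thesis by (simp add: mult.commute)
  qed
  moreover have "poly_below (n - 1) (\<lambda>x. x ^ (k - 1) *\<^sub>R (real k *\<^sub>R C))"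
  \<comment> \<open>For \<open>k = 0\<close> the truncated exponent is harmless because the factor
    \<open>real k\<close> vanishes. This also covers \<open>n = 1\<close>, where the derivative must
    be zero.\<close>
  proof (cases k)
    case 0
    then show ?thesis by (simp add: poly_below_0)
  next
    case (Suc l)
    then show ?thesis using monom by (intro poly_below_monom) simp
  qed
  ultimately show ?case by blast
next
  case (add F G)
  then obtain F' G' where "poly_below (n - 1) F'" "poly_below (n - 1) G'"
    "\<And>x. (F has_vector_derivative F' x) (at x)" "\<And>x. (G has_vector_derivative G' x) (at x)"
    by metis
  then show ?case
    by (intro exI[of _ "\<lambda>x. F' x + G' x"]) (auto intro: poly_below_add has_vector_derivative_add)
qed

lemma poly_below_continuous:
  assumes "poly_below n F"
  shows "continuous_on S F"
  using poly_below_derivative[OF assms]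
  by (metis has_vector_derivative_continuous continuous_at_imp_continuous_on)

text \<open>Each entry of \<open>F\<close> is a complex polynomial that vanishes at all real points.
  A nonzero leading coefficient would allow only finitely many roots.\<close>

lemma poly_below_lead_eq_0:
  assumes "poly_below n (\<lambda>x. F x - x ^ n *\<^sub>R K)" and F: "\<And>x. F x = 0"
  shows "K = 0"
proof -
  obtain q where q: "\<And>x. F x - x ^ n *\<^sub>R K = (\<Sum>k<n. x ^ k *\<^sub>R q k)"
    using assms(1) unfolding poly_below_def by metis
  have "K $ i $ j = 0" for i j
  proof (rule ccontr)
    define c where "c k = (if k = n then K else q k) $ i $ j" for k
    assume "K $ i $ j \<noteq> 0"
    then have "finite {z. (\<Sum>k\<le>n. c k * z ^ k) = 0}"
      by (intro polyfun_roots_finite[of c n]) (auto simp: c_def)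
    moreover have "range of_real \<subseteq> {z. (\<Sum>k\<le>n. c k * z ^ k) = 0}"
    proof (intro image_subsetI CollectI)
      fix x :: real
      have "(\<Sum>k<n. x ^ k *\<^sub>R q k) + x ^ n *\<^sub>R K = 0"
        unfolding q [symmetric] F by simp
      then have "((\<Sum>k<n. x ^ k *\<^sub>R q k) + x ^ n *\<^sub>R K) $ i $ j = 0" by simp
      moreover have "((\<Sum>k<n. x ^ k *\<^sub>R q k) + x ^ n *\<^sub>R K) $ i $ j
          = (\<Sum>k\<le>n. c k * of_real x ^ k)"
        by (simp add: c_def lessThan_Suc_atMost [symmetric])
          (simp add: scaleR_conv_of_real mult.commute)
      ultimately show "(\<Sum>k\<le>n. c k * of_real x ^ k) = 0" by simp
    qed
    moreover have "infinite (range (of_real :: real \<Rightarrow> complex))"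
      by (simp add: finite_image_iff inj_on_def infinite_UNIV_char_0)
    ultimately show False using finite_subset by blast
  qed
  then show ?thesis by (simp add: vec_eq_iff)
qed

text \<open>For monomials on both sides the powers of \<open>x\<close> merge into
  \<open>x ^ (k + l) *\<^sub>R \<rho> x\<close> between constant matrices. Kept abstract in the
  property because it yields both integrability and the limits at infinity.\<close>

lemma poly_below_weight_closure:
  fixes \<rho> :: "real \<Rightarrow> complex^'n^'n"
  assumes "poly_below n F" "poly_below m G"
    and "\<Phi> (\<lambda>_. 0)" and add: "\<And>F G. \<Phi> F \<Longrightarrow> \<Phi> G \<Longrightarrow> \<Phi> (\<lambda>x. F x + G x)"
    and mult: "\<And>F K L. \<Phi> F \<Longrightarrow> \<Phi> (\<lambda>x. K ** F x ** L)"
    and weight: "\<And>k. \<Phi> (\<lambda>x. x ^ k *\<^sub>R \<rho> x)"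
  shows "\<Phi> (\<lambda>x. F x ** \<rho> x ** G x)"
  using assms(1)
proof (induction rule: poly_below_induct)
  case (monom k C)
  show ?case
    using assms(2)
  proof (induction rule: poly_below_induct)
    case (monom l D)
    have "(\<lambda>x. (x ^ k *\<^sub>R C) ** \<rho> x ** (x ^ l *\<^sub>R D)) = (\<lambda>x. C ** (x ^ (k + l) *\<^sub>R \<rho> x) ** D)"
      by (simp add: mm.scaleR_left mm.scaleR_right power_add mult.commute)
    then show ?case using mult[OF weight] by simp
  qed (auto simp: assms(3) mm.zero_right mm.add_right add)
qed (auto simp: assms(3) mm.zero_left mm.add_left add)

section \<open>Orthogonal polynomials for the quartic weight\<close>

locale quartic_mop =
  fixes \<alpha> :: "complex^'n^'n" and P :: "nat \<Rightarrow> real \<Rightarrow> complex^'n^'n"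
  assumes hermitian: "hermitian \<alpha>"
    and mop: "\<And>n. monic_mop (quartic_weight \<alpha>) n (P n)"
begin

abbreviation \<rho> :: "real \<Rightarrow> complex^'n^'n" where "\<rho> \<equiv> quartic_weight \<alpha>"

text \<open>No adjoint is taken of \<open>G\<close>. Constant matrices therefore leave on the outer
  sides, from \<open>F\<close> to the left and from \<open>G\<close> to the right.\<close>

definition pair :: "(real \<Rightarrow> complex^'n^'n) \<Rightarrow> (real \<Rightarrow> complex^'n^'n) \<Rightarrow> complex^'n^'n" where
  "pair F G = (LINT x|lborel. F x ** \<rho> x ** G x)"

definition h :: "nat \<Rightarrow> complex^'n^'n" where
  "h n = pair (P n) (\<lambda>x. x ^ n *\<^sub>R mat 1)"

section \<open>Rules for the matrix-valued pairing\<close>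

lemma integrable_pair:
  assumes "poly_below n F" "poly_below m G"
  shows "integrable lborel (\<lambda>x. F x ** \<rho> x ** G x)"
proof (rule poly_below_weight_closure[OF assms])
  show "integrable lborel (\<lambda>x. K ** H x ** L)" if "integrable lborel H" for H and K L :: "complex^'n^'n"
    by (intro integrable_bounded_linear[OF mm.bounded_linear_left]
        integrable_bounded_linear[OF mm.bounded_linear_right] that)
qed (auto intro: integrable_quartic_weight)

lemma tendsto_pair:
  assumes "poly_below n F" "poly_below m G" and A: "A = at_top \<or> A = at_bot"
  shows "((\<lambda>x. F x ** \<rho> x ** G x) \<longlongrightarrow> 0) A"
proof (rule poly_below_weight_closure[OF assms(1,2)])
  show "((\<lambda>x. K ** H x ** L) \<longlongrightarrow> 0) A" if "(H \<longlongrightarrow> 0) A" for H and K L :: "complex^'n^'n"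
    by (intro mm.tendsto_left_zero mm.tendsto_right_zero that)
qed (auto intro: tendsto_quartic_weight[OF A] tendsto_add_zero)

lemma pair_0_right: "pair F (\<lambda>_. 0) = 0"
  by (simp add: pair_def mm.zero_right)

lemma pair_add_right:
  assumes "poly_below n F" "poly_below m G" "poly_below l H"
  shows "pair F (\<lambda>x. G x + H x) = pair F G + pair F H"
  using assms
  by (auto simp: pair_def mm.add_right intro!: Bochner_Integration.integral_add integrable_pair)

lemma pair_add_left:
  assumes "poly_below n F" "poly_below m G" "poly_below l H"
  shows "pair (\<lambda>x. F x + G x) H = pair F H + pair G H"
  using assms
  by (auto simp: pair_def mm.add_left intro!: Bochner_Integration.integral_add integrable_pair)

lemma pair_diff_left:
  assumes "poly_below n F" "poly_below m G" "poly_below l H"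
  shows "pair (\<lambda>x. F x - G x) H = pair F H - pair G H"
  using assms
  by (auto simp: pair_def mm.diff_left intro!: Bochner_Integration.integral_diff integrable_pair)

lemma pair_lmult:
  assumes "poly_below n F" "poly_below m G"
  shows "pair (\<lambda>x. K ** F x) G = K ** pair F G"
  unfolding pair_def integral_bounded_linear[OF mm.bounded_linear_right integrable_pair[OF assms], symmetric]
  by (simp add: matrix_mul_assoc)

lemma pair_rmult:
  assumes "poly_below n F" "poly_below m G"
  shows "pair F (\<lambda>x. G x ** K) = pair F G ** K"
  unfolding pair_def integral_bounded_linear[OF mm.bounded_linear_left integrable_pair[OF assms], symmetric]
  by (simp add: matrix_mul_assoc)

lemma pair_scale: "pair (\<lambda>x. x *\<^sub>R F x) G = pair F (\<lambda>x. x *\<^sub>R G x)"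
  by (simp add: pair_def mm.scaleR_left mm.scaleR_right)

lemma pair_reflect: "pair F G = pair (\<lambda>x. F (- x)) (\<lambda>x. G (- x))"
  unfolding pair_def
  by (subst lborel_integral_real_affine[where c = "-1" and t = 0])
    (simp_all add: quartic_weight_minus)

section \<open>Orthogonality, nondegeneracy and invertibility of \<open>h n\<close>\<close>

lemma poly_below_P_diff: "poly_below n (\<lambda>x. P n x - x ^ n *\<^sub>R mat 1)"
proof -
  obtain \<gamma> where \<gamma>: "\<And>x. P n x = x ^ n *\<^sub>R mat 1 + (\<Sum>k=1..n. x ^ (n - k) *\<^sub>R \<gamma> k)"
    using mop[of n] by (auto simp: monic_mop_def monic_matrix_poly_def)
  have "(\<Sum>k=1..n. x ^ (n - k) *\<^sub>R \<gamma> k) = (\<Sum>k<n. x ^ k *\<^sub>R \<gamma> (n - k))" for x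
    by (rule sum.reindex_bij_witness[of _ "\<lambda>k. n - k" "\<lambda>k. n - k"]) auto
  then show ?thesis
    unfolding poly_below_def by (intro exI[of _ "\<lambda>k. \<gamma> (n - k)"]) (simp add: \<gamma>)
qed

lemma poly_below_P: "poly_below (Suc n) (P n)"
  using poly_below_add[OF poly_below_mono[OF poly_below_P_diff[of n], of "Suc n"]
      poly_below_monom[of n "Suc n" "mat 1"]]
  by simp

lemma pair_P_monom:
  assumes "j < n"
  shows "pair (P n) (\<lambda>x. x ^ j *\<^sub>R C) = 0"
proof -
  have "(LINT x|lborel. x ^ j *\<^sub>R (P n x ** \<rho> x)) = 0"
    using mop[of n] assms by (auto simp: monic_mop_def has_bochner_integral_iff)
  then have "pair (P n) (\<lambda>x. x ^ j *\<^sub>R mat 1) = 0"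
    by (simp add: pair_def mm.scaleR_right)
  then show ?thesis
    using pair_rmult[OF poly_below_P[of n] poly_below_monom[of j "Suc j" "mat 1"], of C]
    by (simp add: mm.scaleR_left mm.zero_left)
qed

lemma pair_P_lower:
  assumes "poly_below n G"
  shows "pair (P n) G = 0"
proof -
  have "poly_below n G \<and> pair (P n) G = 0"
    using assms
    by (induction rule: poly_below_induct)
      (auto simp: pair_0_right pair_P_monom pair_add_right[OF poly_below_P]
        intro: poly_below_0 poly_below_add poly_below_monom)
  then show ?thesis ..
qed

text \<open>Orthogonality removes everything below degree n, so only the leading coefficient
  contributes. Integrals against \<open>P n\<close> are evaluated this way in
  \<open>string_equation\<close>.\<close>

lemma pair_P_lead:
  assumes "poly_below n (\<lambda>x. G x - x ^ n *\<^sub>R C)"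
  shows "pair (P n) G = h n ** C"
proof -
  have "pair (P n) (\<lambda>x. (G x - x ^ n *\<^sub>R C) + (x ^ n *\<^sub>R mat 1) ** C) = h n ** C"
    using pair_rmult[OF poly_below_P[of n] poly_below_monom[of n "Suc n" "mat 1"], of C]
    by (subst pair_add_right[OF poly_below_P assms])
      (auto simp: pair_P_lower[OF assms] h_def intro: poly_below_rmult poly_below_monom[of _ "Suc n"])
  then show ?thesis by (simp add: mm.scaleR_left)
qed

text \<open>By right linearity \<open>F\<close> is orthogonal to every polynomial of degree below n,
  in particular to its own adjoint, and positive definiteness applies. Used on differences, this is
  the uniqueness principle behind commutation, parity and the recurrence.\<close>

lemma pair_nondegenerate:
  assumes F: "poly_below n F" and 0: "\<And>j. j < n \<Longrightarrow> pair F (\<lambda>x. x ^ j *\<^sub>R mat 1) = 0"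
  shows "F x = 0"
proof -
  have "poly_below n G \<and> pair F G = 0" if "poly_below n G" for G
    using that
  proof (induction rule: poly_below_induct)
    case (monom j C)
    then show ?case
      using pair_rmult[OF F poly_below_monom[of j n "mat 1"], of C] 0[of j]
      by (simp add: poly_below_monom mm.scaleR_left mm.zero_left)
  qed (auto simp: pair_0_right pair_add_right[OF F] intro: poly_below_0 poly_below_add)
  from this[OF poly_below_adj[OF F]] have "pair F (\<lambda>x. adj (F x)) = 0" by simp
  then show ?thesis
    using integrable_pair[OF F poly_below_adj[OF F]]
    by (intro integral_quartic_weight_adj_eq_0[OF hermitian poly_below_continuous[OF F]])
      (simp add: pair_def has_bochner_integral_iff)
qed

text \<open>If \<open>K\<close> annihilates \<open>h n\<close> from the left, then
  \<open>K ** P n x\<close> is orthogonal to the monomial of degree n as well as to the lower ones.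
  Being of degree at most n, it vanishes, and its leading coefficient is \<open>K\<close>.\<close>

lemma invertible_h: "invertible (h n)"
proof (rule invertible_if_left_kernel_trivial)
  fix K :: "complex^'n^'n"
  assume K: "K ** h n = 0"
  have "K ** P n x = 0" for x
  proof (rule pair_nondegenerate[where F = "\<lambda>x. K ** P n x"])
    show "poly_below (Suc n) (\<lambda>x. K ** P n x)"
      by (rule poly_below_lmult[OF poly_below_P])
    fix j assume "j < Suc n"
    then show "pair (\<lambda>x. K ** P n x) (\<lambda>x. x ^ j *\<^sub>R mat 1) = 0"
      using K by (cases "j = n")
        (simp_all add: pair_lmult[OF poly_below_P poly_below_monom[of _ "Suc n"]] pair_P_monom
          mm.zero_right flip: h_def)
  qed
  then show "K = 0"
    using poly_below_lmult[OF poly_below_P_diff, of n K]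
    by (intro poly_below_lead_eq_0[of n "\<lambda>x. K ** P n x" K])
      (simp_all add: mm.diff_right mm.scaleR_right)
qed

text \<open>Everything built from the moments lies in the bicommutant of \<open>\<alpha>\<close>, hence commutes.\<close>

lemma P_commute:
  assumes K: "K ** \<alpha> = \<alpha> ** K"
  shows "K ** P n x = P n x ** K"
proof -
  have "K ** P n x - P n x ** K = 0"
  proof (rule pair_nondegenerate)
    have "poly_below n (\<lambda>x. K ** (P n x - x ^ n *\<^sub>R mat 1) - (P n x - x ^ n *\<^sub>R mat 1) ** K)"
      by (intro poly_below_diff poly_below_lmult poly_below_rmult poly_below_P_diff)
    then show "poly_below n (\<lambda>x. K ** P n x - P n x ** K)"
      by (simp add: mm.diff_right mm.diff_left mm.scaleR_right mm.scaleR_left)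
    fix j assume j: "j < n"
    have m: "poly_below (Suc j) (\<lambda>x. x ^ j *\<^sub>R mat 1)" by (simp add: poly_below_monom)
    have "pair (\<lambda>x. P n x ** K) (\<lambda>x. x ^ j *\<^sub>R mat 1) = pair (P n) (\<lambda>x. x ^ j *\<^sub>R K)"
      unfolding pair_def
      by (simp add: mm.scaleR_right matrix_mul_assoc [symmetric] quartic_weight_commute[OF K])
    then show "pair (\<lambda>x. K ** P n x - P n x ** K) (\<lambda>x. x ^ j *\<^sub>R mat 1) = 0"
      using j
      by (simp add: pair_diff_left[OF poly_below_lmult[OF poly_below_P] poly_below_rmult[OF poly_below_P] m]
          pair_lmult[OF poly_below_P m] pair_P_monom mm.zero_right)
  qed
  then show ?thesis by simp
qed

lemma h_commute:
  assumes K: "K ** \<alpha> = \<alpha> ** K"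
  shows "K ** h n = h n ** K"
proof -
  have m: "poly_below (Suc n) (\<lambda>x. x ^ n *\<^sub>R mat 1)" by (simp add: poly_below_monom)
  have "K ** h n = pair (\<lambda>x. K ** P n x) (\<lambda>x. x ^ n *\<^sub>R mat 1)"
    unfolding h_def by (rule pair_lmult[OF poly_below_P m, symmetric])
  also have "\<dots> = pair (P n) (\<lambda>x. x ^ n *\<^sub>R mat 1 ** K)"
    unfolding pair_def P_commute[OF K]
    by (simp add: mm.scaleR_right mm.scaleR_left matrix_mul_assoc [symmetric] quartic_weight_commute[OF K])
  also have "\<dots> = h n ** K"
    unfolding h_def by (rule pair_rmult[OF poly_below_P m])
  finally show ?thesis .
qed

text \<open>The values of \<open>F\<close>, the weight and \<open>P n\<close> commute with one
  another, so the integrand may be reversed. This makes the orthogonality of \<open>P n\<close>,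
  available on the left, usable on the right.\<close>

lemma pair_swap:
  assumes F: "\<And>x. F x ** \<alpha> = \<alpha> ** F x"
  shows "pair F (P n) = pair (P n) F"
proof -
  have "F x ** \<rho> x ** P n x = P n x ** \<rho> x ** F x" for x
  proof -
    have "F x ** \<rho> x ** P n x = \<rho> x ** (F x ** P n x)"
      by (simp only: quartic_weight_commute[OF F] matrix_mul_assoc)
    also have "\<dots> = (\<rho> x ** P n x) ** F x"
      by (simp only: P_commute[OF F] matrix_mul_assoc)
    also have "\<rho> x ** P n x = P n x ** \<rho> x"
      by (rule P_commute) (rule quartic_weight_commute[OF refl, symmetric])
    finally show ?thesis .
  qed
  then show ?thesis by (simp add: pair_def)
qed

section \<open>Parity and the three-term recurrence\<close>

text \<open>The weight is even, so the reflected polynomial with sign \<open>(- 1) ^ n\<close> is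
  again monic and orthogonal. Its difference from \<open>P n\<close> has degree below n and vanishes
  by \<open>pair_nondegenerate\<close>.\<close>

lemma P_minus: "P n (- x) = (- 1) ^ n *\<^sub>R P n x"
proof -
  let ?K = "(- 1) ^ n *\<^sub>R mat 1 :: complex^'n^'n"
  have e: "(- 1) ^ n * (- x) ^ n = x ^ n" for x :: real
    by (simp flip: power_mult_distrib)
  have e': "(- x) ^ n * (- 1) ^ n = x ^ n" for x :: real
    by (simp flip: power_mult_distrib)
  have "?K ** P n (- x) - P n x = 0"
  proof (rule pair_nondegenerate)
    have "poly_below n (\<lambda>x. ?K ** (P n (- x) - (- x) ^ n *\<^sub>R mat 1) - (P n x - x ^ n *\<^sub>R mat 1))"
      by (intro poly_below_diff poly_below_lmult poly_below_reflect[of n "\<lambda>x. P n x - x ^ n *\<^sub>R mat 1"]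
          poly_below_P_diff)
    then show "poly_below n (\<lambda>x. ?K ** P n (- x) - P n x)"
      by (simp add: mm.diff_right mm.scaleR_right mm.scaleR_left scaleR_diff_right e e')
    fix j assume j: "j < n"
    have m: "poly_below (Suc j) (\<lambda>x. x ^ j *\<^sub>R mat 1)" by (simp add: poly_below_monom)
    have "pair (\<lambda>x. P n (- x)) (\<lambda>x. x ^ j *\<^sub>R mat 1) = pair (P n) (\<lambda>x. (- x) ^ j *\<^sub>R mat 1)"
      by (subst pair_reflect) simp
    also have "(\<lambda>x. (- x) ^ j *\<^sub>R mat 1) = (\<lambda>x::real. x ^ j *\<^sub>R ((- 1) ^ j *\<^sub>R mat 1 :: complex^'n^'n))"
    proof
      fix x :: real
      show "(- x) ^ j *\<^sub>R mat 1 = x ^ j *\<^sub>R ((- 1) ^ j *\<^sub>R mat 1 :: complex^'n^'n)"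
        by (simp only: power_minus[of x] scaleR_scaleR mult.commute)
    qed
    finally have "pair (\<lambda>x. P n (- x)) (\<lambda>x. x ^ j *\<^sub>R mat 1) = 0"
      by (simp only: pair_P_monom[OF j])
    then show "pair (\<lambda>x. ?K ** P n (- x) - P n x) (\<lambda>x. x ^ j *\<^sub>R mat 1) = 0"
      by (simp only: pair_diff_left[OF poly_below_lmult[OF poly_below_reflect[OF poly_below_P]] poly_below_P m]
          pair_lmult[OF poly_below_reflect[OF poly_below_P] m] pair_P_monom[OF j] mm.zero_right diff_self)
  qed
  then have "(- 1) ^ n *\<^sub>R (?K ** P n (- x)) = (- 1) ^ n *\<^sub>R P n x" by simp
  then show ?thesis by (simp add: mm.scaleR_left flip: power_mult_distrib)
qed

text \<open>The integrand is odd, so the integral equals its own negative. This is why the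
  recurrence has no term in \<open>P n\<close> on the right.\<close>

lemma pair_P_Suc: "pair (P n) (\<lambda>x. x ^ Suc n *\<^sub>R mat 1) = 0"
proof -
  have "P n (- x) ** \<rho> x ** ((- x) ^ Suc n *\<^sub>R mat 1) = - (P n x ** \<rho> x ** (x ^ Suc n *\<^sub>R mat 1))" for x
  proof -
    have "(- 1) ^ n * (- x) ^ Suc n = - (x ^ Suc n)" "(- x) ^ Suc n * (- 1) ^ n = - (x ^ Suc n)"
      by (simp_all flip: power_mult_distrib)
    then show ?thesis
      by (simp only: P_minus mm.scaleR_left mm.scaleR_right scaleR_scaleR scaleR_minus_left)
  qed
  then have "pair (P n) (\<lambda>x. x ^ Suc n *\<^sub>R mat 1) = - pair (P n) (\<lambda>x. x ^ Suc n *\<^sub>R mat 1)"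
    by (subst pair_reflect) (simp only: pair_def Bochner_Integration.integral_minus)
  then have "2 *\<^sub>R pair (P n) (\<lambda>x. x ^ Suc n *\<^sub>R mat 1) = 0"
    by (simp only: eq_neg_iff_add_eq_0 scaleR_2)
  then show ?thesis by (simp only: scaleR_eq_0_iff) simp
qed

text \<open>The value 0 at \<open>n = 0\<close> mutes the term \<open>P (0 - 1)\<close>, which is
  \<open>P 0\<close>, in the recurrence.\<close>

definition B :: "nat \<Rightarrow> complex^'n^'n" where
  "B n = (if n = 0 then 0 else h n ** matrix_inv (h (n - 1)))"

text \<open>The leading terms cancel, so the difference has degree at most n and is tested against
  \<open>x ^ j\<close> for \<open>j \<le> n\<close>. Parity settles \<open>j = n\<close>, the choice
  of \<open>B n\<close> settles \<open>j = n - 1\<close>, and orthogonality settles the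
  rest.\<close>

lemma three_term: "x *\<^sub>R P n x = P (Suc n) x + B n ** P (n - 1) x"
proof -
  have "x *\<^sub>R P n x - P (Suc n) x - B n ** P (n - 1) x = 0"
  proof (rule pair_nondegenerate)
    have "poly_below (Suc n) (\<lambda>x. x *\<^sub>R (P n x - x ^ n *\<^sub>R mat 1) - (P (Suc n) x - x ^ Suc n *\<^sub>R mat 1)
        - B n ** P (n - 1) x)"
      by (intro poly_below_diff poly_below_scale poly_below_lmult poly_below_P_diff
          poly_below_mono[OF poly_below_P]) simp
    then show *: "poly_below (Suc n) (\<lambda>x. x *\<^sub>R P n x - P (Suc n) x - B n ** P (n - 1) x)"
      by (simp add: scaleR_diff_right)
    fix j assume j: "j < Suc n"
    let ?m = "\<lambda>j x. x ^ j *\<^sub>R (mat 1 :: complex^'n^'n)"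
    have m: "poly_below (Suc j) (?m j)" by (simp add: poly_below_monom)
    have "pair (\<lambda>x. x *\<^sub>R P n x - P (Suc n) x - B n ** P (n - 1) x) (?m j) =
        pair (\<lambda>x. x *\<^sub>R P n x) (?m j) - pair (P (Suc n)) (?m j) - B n ** pair (P (n - 1)) (?m j)"
      by (simp only: pair_diff_left[OF poly_below_diff[OF poly_below_scale[OF poly_below_P]
            poly_below_P] poly_below_lmult[OF poly_below_P] m]
          pair_diff_left[OF poly_below_scale[OF poly_below_P] poly_below_P m]
          pair_lmult[OF poly_below_P m])
    also have "pair (\<lambda>x. x *\<^sub>R P n x) (?m j) = pair (P n) (?m (Suc j))"
      by (simp add: pair_scale)
    also have "pair (P (Suc n)) (?m j) = 0" using j by (rule pair_P_monom)
    also have "pair (P n) (?m (Suc j)) - 0 - B n ** pair (P (n - 1)) (?m j) = 0"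
    proof -
      consider "j = n" "n = 0" | "j = n" "n > 0" | "Suc j = n" | "Suc j < n" using j by linarith
      then show ?thesis
      proof cases
        case 1
        then show ?thesis using pair_P_Suc[of n] by (simp add: B_def mm.zero_left)
      next
        case 2
        then obtain m where "n = Suc m" using gr0_implies_Suc by blast
        with 2 show ?thesis using pair_P_Suc[of n] pair_P_Suc[of m] by (simp add: mm.zero_right)
      next
        case 3
        then have "B n ** h j = h n"
          by (auto simp: B_def matrix_mul_assoc [symmetric] matrix_inv_matrix_mul[OF invertible_h])
        with 3 show ?thesis by (auto simp: h_def)
      next
        case 4
        then show ?thesis by (simp only: pair_P_monom[of j "n - 1"] pair_P_monom[of "Suc j" n] mm.zero_right diff_self)
      qed
    qed
    finally show "pair (\<lambda>x. x *\<^sub>R P n x - P (Suc n) x - B n ** P (n - 1) x) (?m j) = 0" .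
  qed
  then show ?thesis by (simp add: algebra_simps)
qed

section \<open>Integration by parts and the string equation\<close>

text \<open>The derivative of \<open>F x ** \<rho> x ** G x\<close> integrates to 0 because the
  product vanishes at both ends. The right-hand side comes from differentiating the weight; its
  factor \<open>\<alpha>\<close> stands to the left of \<open>\<rho> x\<close> and is therefore
  attached to \<open>F\<close>.\<close>

lemma pair_by_parts:
  assumes F: "poly_below n F" "poly_below n' F'" "\<And>x. (F has_vector_derivative F' x) (at x)"
    and G: "poly_below m G" "poly_below m' G'" "\<And>x. (G has_vector_derivative G' x) (at x)"
  shows "pair F' G + pair F G' =
    2 *\<^sub>R pair (\<lambda>x. x *\<^sub>R (F x ** \<alpha>)) G + 4 *\<^sub>R pair (\<lambda>x. x ^ 3 *\<^sub>R F x) G"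
proof -
  let ?g = "\<lambda>x. F' x ** \<rho> x ** G x + F x ** \<rho> x ** G' x
    - 2 *\<^sub>R ((x *\<^sub>R (F x ** \<alpha>)) ** \<rho> x ** G x) - 4 *\<^sub>R ((x ^ 3 *\<^sub>R F x) ** \<rho> x ** G x)"
  note int = integrable_pair[OF F(2) G(1)] integrable_pair[OF F(1) G(2)]
    integrable_pair[OF poly_below_scale[OF poly_below_rmult[OF F(1)]] G(1)]
    integrable_pair[OF poly_below_scale_power[OF F(1)] G(1)]
  have deriv: "((\<lambda>x. F x ** \<rho> x ** G x) has_vector_derivative ?g x) (at x)" for x
    using mm.has_vector_derivative[OF mm.has_vector_derivative[OF F(3) quartic_weight_has_vector_derivative] G(3)]
    by (rule has_vector_derivative_eq_rhs)
      (simp add: mm.add_left mm.add_right mm.diff_left mm.diff_right mm.minus_left mm.minus_right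
        mm.scaleR_left mm.scaleR_right matrix_mul_assoc scaleR_add_right)
  have "continuous_on UNIV ?g"
    by (intro continuous_intros mm.continuous_on
        poly_below_continuous[OF F(1)] poly_below_continuous[OF F(2)]
        poly_below_continuous[OF G(1)] poly_below_continuous[OF G(2)])
  then have cont: "isCont ?g x" for x
    by (simp add: continuous_on_eq_continuous_at)
  have gint: "integrable lborel ?g"
    by (intro Bochner_Integration.integrable_diff Bochner_Integration.integrable_add
        integrable_scaleR_right int)
  have lim: "((\<lambda>x. F x ** \<rho> x ** G x) \<longlongrightarrow> 0) at_top" "((\<lambda>x. F x ** \<rho> x ** G x) \<longlongrightarrow> 0) at_bot"
    by (auto intro: tendsto_pair[OF F(1) G(1)])
  have "(LBINT x=-\<infinity>..\<infinity>. ?g x) = 0 - 0"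
    using deriv cont gint lim
    by (intro interval_integral_FTC_integrable[where F = "\<lambda>x. F x ** \<rho> x ** G x"])
      (auto simp: ereal_tendsto_simps set_integrable_def)
  then have "(LINT x|lborel. ?g x) = 0"
    by (simp add: interval_lebesgue_integral_def set_lebesgue_integral_def)
  moreover have "(LINT x|lborel. ?g x) = pair F' G + pair F G'
    - 2 *\<^sub>R pair (\<lambda>x. x *\<^sub>R (F x ** \<alpha>)) G - 4 *\<^sub>R pair (\<lambda>x. x ^ 3 *\<^sub>R F x) G"
    unfolding pair_def
    by (simp only: Bochner_Integration.integral_diff Bochner_Integration.integral_add
        integral_scaleR_right integrable_scaleR_right int Bochner_Integration.integrable_diff
        Bochner_Integration.integrable_add)
  ultimately show ?thesis by (simp add: algebra_simps)
qed

lemma P_commute_alpha: "P n x ** \<alpha> = \<alpha> ** P n x"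
  by (rule P_commute[OF refl, symmetric])

text \<open>This is \<open>pair_by_parts\<close> for \<open>F = P m\<close> and
  \<open>G = P (Suc m)\<close>. Of the two derivative terms one dies by orthogonality and the other
  gives \<open>h m\<close>; the quadratic part of the potential gives the term in
  \<open>\<alpha>\<close>, and the recurrence expands the quartic part.\<close>

lemma string_equation:
  "real (Suc m) *\<^sub>R h m = 2 *\<^sub>R (h (Suc m) ** \<alpha>) +
     4 *\<^sub>R (h (Suc m) ** B m + h (Suc (Suc m)) + B (Suc m) ** h (Suc m))"
proof -
  let ?p = "P (Suc m)" and ?r = "P m"
  obtain r' where r': "poly_below m r'" "\<And>x. (?r has_vector_derivative r' x) (at x)"
    using poly_below_derivative[OF poly_below_P[of m]] by auto
  \<comment> \<open>Differentiating the monic term separately exposes the leading coefficient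
    \<open>real (Suc m)\<close> of \<open>p'\<close>, as \<open>pair_P_lead\<close>
    requires.\<close>
  obtain l' where l': "poly_below m l'"
    "\<And>x. ((\<lambda>x. ?p x - x ^ Suc m *\<^sub>R mat 1) has_vector_derivative l' x) (at x)"
    using poly_below_derivative[OF poly_below_P_diff[of "Suc m"]] by auto
  define p' where "p' x = x ^ m *\<^sub>R (real (Suc m) *\<^sub>R mat 1) + l' x" for x
  have p': "(?p has_vector_derivative p' x) (at x)" for x
  proof -
    have "((\<lambda>x. x ^ Suc m) has_real_derivative real (Suc m) * x ^ m) (at x)"
      using DERIV_pow[of "Suc m" x UNIV] by simp
    from has_vector_derivative_add[OF has_vector_derivative_scaleR[OF this
          has_vector_derivative_const[of "mat 1"]] l'(2)]
    show ?thesis by (simp add: p'_def mult.commute)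
  qed
  have pb_p': "poly_below (Suc m) p'"
    unfolding p'_def
    by (intro poly_below_add poly_below_monom poly_below_mono[OF l'(1)]) auto
  \<comment> \<open>Commutation with \<open>\<alpha>\<close> passes from \<open>P m\<close> to its
    derivative, so \<open>pair_swap\<close> can bring \<open>P (Suc m)\<close> to the left, where
    orthogonality applies.\<close>
  have "r' x ** \<alpha> = \<alpha> ** r' x" for x
  proof (rule vector_derivative_unique_at)
    show "((\<lambda>x. ?r x ** \<alpha>) has_vector_derivative r' x ** \<alpha>) (at x)"
      by (rule bounded_linear.has_vector_derivative[OF mm.bounded_linear_left r'(2)])
    show "((\<lambda>x. ?r x ** \<alpha>) has_vector_derivative \<alpha> ** r' x) (at x)"
      unfolding P_commute_alpha
      by (rule bounded_linear.has_vector_derivative[OF mm.bounded_linear_right r'(2)])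
  qed
  then have 1: "pair r' ?p = 0"
    by (simp add: pair_swap pair_P_lower[OF poly_below_mono[OF r'(1)]])
  have 2: "pair ?r p' = real (Suc m) *\<^sub>R h m"
    using l'(1) by (subst pair_P_lead[of m p' "real (Suc m) *\<^sub>R mat 1"])
      (simp_all add: p'_def mm.scaleR_right)
  have 3: "pair (\<lambda>x. x *\<^sub>R (?r x ** \<alpha>)) ?p = h (Suc m) ** \<alpha>"
  proof (subst pair_swap)
    show "(x *\<^sub>R (?r x ** \<alpha>)) ** \<alpha> = \<alpha> ** (x *\<^sub>R (?r x ** \<alpha>))" for x
      unfolding mm.scaleR_left mm.scaleR_right by (metis P_commute_alpha matrix_mul_assoc)
    show "pair ?p (\<lambda>x. x *\<^sub>R (?r x ** \<alpha>)) = h (Suc m) ** \<alpha>"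
      using poly_below_scale[OF poly_below_rmult[OF poly_below_P_diff[of m], of \<alpha>]]
      by (intro pair_P_lead) (simp add: mm.diff_left mm.scaleR_left scaleR_diff_right)
  qed
  have xr: "pair ?p (\<lambda>x. x *\<^sub>R ?r x) = h (Suc m)"
    using poly_below_scale[OF poly_below_P_diff[of m]]
    by (subst pair_P_lead[of _ _ "mat 1"]) (simp_all add: scaleR_diff_right)
  \<comment> \<open>One factor \<open>x\<close> moves to the left polynomial, where the recurrence
    replaces it; both resulting pairings depend only on leading coefficients.\<close>
  have "pair ?p (\<lambda>x. x\<^sup>2 *\<^sub>R ?p x) = pair (\<lambda>x. x *\<^sub>R ?p x) (\<lambda>x. x *\<^sub>R ?p x)"
    by (simp add: pair_scale power2_eq_square)
  also have "\<dots> = pair (\<lambda>x. P (Suc (Suc m)) x + B (Suc m) ** ?r x) (\<lambda>x. x *\<^sub>R ?p x)"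
    by (simp add: three_term[of _ "Suc m"])
  also have "\<dots> = pair (P (Suc (Suc m))) (\<lambda>x. x *\<^sub>R ?p x) + B (Suc m) ** pair ?r (\<lambda>x. x *\<^sub>R ?p x)"
    by (simp only: pair_add_left[OF poly_below_P poly_below_lmult[OF poly_below_P]
          poly_below_scale[OF poly_below_P]] pair_lmult[OF poly_below_P poly_below_scale[OF poly_below_P]])
  also have "pair (P (Suc (Suc m))) (\<lambda>x. x *\<^sub>R ?p x) = h (Suc (Suc m))"
    using poly_below_scale[OF poly_below_P_diff[of "Suc m"]]
    by (subst pair_P_lead[of _ _ "mat 1"]) (simp_all add: scaleR_diff_right)
  also have "pair ?r (\<lambda>x. x *\<^sub>R ?p x) = pair (\<lambda>x. x *\<^sub>R ?r x) ?p"
    by (simp add: pair_scale)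
  also have "\<dots> = h (Suc m)"
    by (subst pair_swap) (simp_all add: xr mm.scaleR_left mm.scaleR_right P_commute_alpha)
  finally have xxp: "pair ?p (\<lambda>x. x\<^sup>2 *\<^sub>R ?p x) = h (Suc (Suc m)) + B (Suc m) ** h (Suc m)" .
  have xxq: "pair ?p (\<lambda>x. x\<^sup>2 *\<^sub>R (B m ** P (m - 1) x)) = h (Suc m) ** B m"
  proof (cases m)
    case 0
    then show ?thesis by (simp add: B_def pair_0_right mm.zero_left mm.zero_right)
  next
    case (Suc k)
    then show ?thesis
      using poly_below_scale_power[OF poly_below_lmult[OF poly_below_P_diff[of k], of "B m"], of 2]
      by (intro pair_P_lead)
        (simp add: mm.diff_right mm.scaleR_right scaleR_diff_right power2_eq_square mult_ac)
  qed
  have "pair (\<lambda>x. x ^ 3 *\<^sub>R ?r x) ?p = pair ?p (\<lambda>x. x ^ 3 *\<^sub>R ?r x)"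
    by (rule pair_swap) (simp add: mm.scaleR_left mm.scaleR_right P_commute_alpha)
  \<comment> \<open>The recurrence for \<open>x *\<^sub>R P m x\<close> leaves a factor
    \<open>x\<^sup>2\<close>, which splits the cubic moment into \<open>xxp\<close> and
    \<open>xxq\<close>.\<close>
  also have "\<dots> = pair ?p (\<lambda>x. x\<^sup>2 *\<^sub>R ?p x + x\<^sup>2 *\<^sub>R (B m ** P (m - 1) x))"
  proof -
    have "x ^ 3 *\<^sub>R ?r x = x\<^sup>2 *\<^sub>R (x *\<^sub>R ?r x)" for x
      by (simp add: power2_eq_square power3_eq_cube)
    then show ?thesis by (simp add: three_term[of _ m] scaleR_add_right)
  qed
  also have "\<dots> = h (Suc (Suc m)) + B (Suc m) ** h (Suc m) + h (Suc m) ** B m"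
    by (simp only: pair_add_right[OF poly_below_P poly_below_scale_power[OF poly_below_P]
          poly_below_scale_power[OF poly_below_lmult[OF poly_below_P]]] xxp xxq)
  finally have 4: "pair (\<lambda>x. x ^ 3 *\<^sub>R ?r x) ?p =
    h (Suc (Suc m)) + B (Suc m) ** h (Suc m) + h (Suc m) ** B m" .
  from pair_by_parts[OF poly_below_P r' poly_below_P pb_p' p'] show ?thesis
    by (simp add: 1 2 3 4 add_ac)
qed

lemma B_commute_alpha: "B n ** \<alpha> = \<alpha> ** B n"
proof -
  have "\<alpha> ** h k = h k ** \<alpha>" for k by (rule h_commute[OF refl])
  moreover have "\<alpha> ** matrix_inv (h k) = matrix_inv (h k) ** \<alpha>" for k
    by (intro matrix_inv_commute invertible_h h_commute refl)
  ultimately show ?thesis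
    by (simp add: B_def mm.zero_left mm.zero_right) (metis matrix_mul_assoc)
qed

text \<open>The string equation is multiplied on the right by the inverse of
  \<open>h (Suc m)\<close>. Commutation frees \<open>\<alpha>\<close> and \<open>B m\<close> from
  the surrounding factors, and the quotient formed with \<open>h (Suc (Suc m))\<close> is the next
  \<open>B\<close>.\<close>

lemma discrete_painleve:
  "4 *\<^sub>R (B m + B (Suc (Suc m)) + B (Suc m)) =
     real (Suc m) *\<^sub>R (h m ** matrix_inv (h (Suc m))) - 2 *\<^sub>R \<alpha>"
proof -
  let ?i = "matrix_inv (h (Suc m))"
  note hi = matrix_mul_matrix_inv[OF invertible_h, of "Suc m"]
  have 1: "h (Suc m) ** \<alpha> ** ?i = \<alpha>"
    by (simp add: h_commute[OF refl, symmetric] matrix_mul_assoc [symmetric] hi)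
  have 2: "h (Suc m) ** B m ** ?i = B m"
    by (simp add: h_commute[OF B_commute_alpha, symmetric] matrix_mul_assoc [symmetric] hi)
  have 3: "B (Suc m) ** h (Suc m) ** ?i = B (Suc m)"
    by (simp add: matrix_mul_assoc [symmetric] hi)
  have "real (Suc m) *\<^sub>R (h m ** ?i) = (real (Suc m) *\<^sub>R h m) ** ?i"
    by (simp only: mm.scaleR_left)
  also have "\<dots> = 2 *\<^sub>R \<alpha> + 4 *\<^sub>R (B m + B (Suc (Suc m)) + B (Suc m))"
    unfolding string_equation
    by (simp add: mm.add_left mm.scaleR_left 1 2 3) (simp add: B_def)
  finally show ?thesis by simp
qed

section \<open>Return to \<open>c_mat\<close> and \<open>beta_mat\<close>\<close>

lemma h_eq: "h n = (LINT x|lborel. x ^ n *\<^sub>R (P n x ** \<rho> x))"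
  by (simp add: h_def pair_def mm.scaleR_right)

lemma integrable_h: "integrable lborel (\<lambda>x. x ^ n *\<^sub>R (P n x ** \<rho> x))"
  using integrable_pair[OF poly_below_P[of n] poly_below_monom[of n "Suc n" "mat 1"]]
  by (simp add: mm.scaleR_right)

text \<open>\<open>c_inv\<close> is a nonzero scalar multiple of \<open>h n\<close>, so its inverse
  is the reciprocal multiple of the inverse of \<open>h n\<close>. The two scalars cancel in
  \<open>beta_mat\<close>.\<close>

lemma
  shows invertible_c_inv: "invertible (c_inv \<rho> P n)"
    and c_mat_eq: "c_mat \<rho> P n =
      map_matrix (\<lambda>z. - (2 * of_real pi * \<i>) * z) (matrix_inv (h n))"
    and matrix_inv_c_mat: "matrix_inv (c_mat \<rho> P n) = c_inv \<rho> P n"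
proof -
  let ?C = "map_matrix (\<lambda>z. - (2 * of_real pi * \<i>) * z) (matrix_inv (h n))"
  have s: "- (1 / (2 * of_real pi * \<i>)) * - (2 * of_real pi * \<i>) = 1"
    "- (2 * of_real pi * \<i>) * - (1 / (2 * of_real pi * \<i>)) = 1"
    by (simp_all add: field_simps)
  have id: "map_matrix (\<lambda>z. 1 * z) A = A" for A :: "complex^'n^'n"
    by (simp add: vec_eq_iff)
  have *: "c_inv \<rho> P n ** ?C = mat 1" "?C ** c_inv \<rho> P n = mat 1"
    unfolding c_inv_def h_eq [symmetric] matrix_mult_map_matrix_scale s id
    by (rule matrix_mul_matrix_inv[OF invertible_h] matrix_inv_matrix_mul[OF invertible_h])+
  then show "invertible (c_inv \<rho> P n)" by (auto simp: invertible_def)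
  show "c_mat \<rho> P n = ?C"
    unfolding c_mat_def using * by (rule matrix_inv_eqI)
  then show "matrix_inv (c_mat \<rho> P n) = c_inv \<rho> P n"
    using * by (auto intro: matrix_inv_eqI)
qed

lemma beta_mat_eq: "beta_mat \<rho> P n = 2 *\<^sub>R B n"
proof -
  have s: "- (1 / (2 * of_real pi * \<i>)) * - (2 * of_real pi * \<i>) = 1"
    by (simp add: field_simps)
  have id: "map_matrix (\<lambda>z. 1 * z) A = A" for A :: "complex^'n^'n"
    by (simp add: vec_eq_iff)
  show ?thesis
    unfolding beta_mat_def B_def matrix_inv_c_mat
    unfolding c_mat_eq c_inv_def h_eq [symmetric]
      matrix_mult_map_matrix_scale s id by simp
qed

lemma
  fixes m
  defines "C \<equiv> (1/2) *\<^sub>R (h m ** matrix_inv (h (Suc m)))"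
  shows invertible_beta_mat: "invertible (beta_mat \<rho> P (Suc m))"
    and matrix_inv_beta_mat: "matrix_inv (beta_mat \<rho> P (Suc m)) = C"
proof -
  note hi = matrix_mul_matrix_inv[OF invertible_h] matrix_inv_matrix_mul[OF invertible_h]
  have "h (Suc m) ** (matrix_inv (h m) ** h m) ** matrix_inv (h (Suc m)) = mat 1"
    "h m ** (matrix_inv (h (Suc m)) ** h (Suc m)) ** matrix_inv (h m) = mat 1"
    by (simp_all add: hi)
  then have "beta_mat \<rho> P (Suc m) ** C = mat 1" "C ** beta_mat \<rho> P (Suc m) = mat 1"
    by (simp_all add: beta_mat_eq B_def C_def mm.scaleR_left mm.scaleR_right matrix_mul_assoc)
  then show "invertible (beta_mat \<rho> P (Suc m))" "matrix_inv (beta_mat \<rho> P (Suc m)) = C"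
    by (auto simp: invertible_def intro: matrix_inv_eqI)
qed

end

theorem theorem1:
  fixes \<alpha> :: "complex^'n^'n"
    and P :: "nat \<Rightarrow> real \<Rightarrow> complex^'n^'n"
    and \<rho> :: "real \<Rightarrow> complex^'n^'n"
    and \<beta> :: "nat \<Rightarrow> complex^'n^'n"
  assumes "hermitian \<alpha>"
    and "\<rho> = quartic_weight \<alpha>"
    and "\<And>n. monic_mop \<rho> n (P n)"
    and "\<beta> = beta_mat \<rho> P"
  shows "(\<forall>n. integrable lborel (\<lambda>x. x^n *\<^sub>R (P n x ** \<rho> x)) \<and> invertible (c_inv \<rho> P n)) \<and>
    (\<forall>n\<ge>1. invertible (\<beta> n) \<and>
      \<beta> (n + 1) = real n *\<^sub>R matrix_inv (\<beta> n) - \<beta> (n - 1) - \<beta> n - \<alpha>)"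
proof -
  interpret quartic_mop \<alpha> P
    using assms by unfold_locales auto
  have "invertible (\<beta> n) \<and>
      \<beta> (n + 1) = real n *\<^sub>R matrix_inv (\<beta> n) - \<beta> (n - 1) - \<beta> n - \<alpha>" if "n \<ge> 1" for n
  proof -
    obtain m where n: "n = Suc m" using \<open>n \<ge> 1\<close> by (cases n) auto
    \<comment> \<open>Halving matches the normalization \<open>\<beta> n = 2 *\<^sub>R B n\<close>:
      each \<open>B\<close> keeps a factor 2, the quotient of the \<open>h\<close> becomes the
      inverse of \<open>\<beta> n\<close>, and \<open>\<alpha>\<close> gets coefficient 1.\<close>
    have "(1/2) *\<^sub>R (4 *\<^sub>R (B m + B (Suc (Suc m)) + B (Suc m))) =
        (1/2) *\<^sub>R (real (Suc m) *\<^sub>R (h m ** matrix_inv (h (Suc m))) - 2 *\<^sub>R \<alpha>)"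
      by (simp only: discrete_painleve)
    then have "2 *\<^sub>R B (Suc (Suc m)) = real (Suc m) *\<^sub>R ((1/2) *\<^sub>R (h m ** matrix_inv (h (Suc m))))
        - 2 *\<^sub>R B m - 2 *\<^sub>R B (Suc m) - \<alpha>"
      by (simp add: scaleR_add_right scaleR_diff_right eq_diff_eq diff_eq_eq add_ac)
    moreover have "matrix_inv (\<beta> n) = (1/2) *\<^sub>R (h m ** matrix_inv (h (Suc m)))"
      using matrix_inv_beta_mat[of m] assms n by simp
    ultimately show ?thesis
      using invertible_beta_mat[of m] assms n by (simp add: beta_mat_eq)
  qed
  then show ?thesis
    using assms integrable_h invertible_c_inv by blast
qed

end
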